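(* Consider the discrete-time linear time-invariant system $$x_{k+1}=Ax_k+Bu_k,\qquad y_k=Cx_k+Du_k,$$ with $x_k\in\mathbb{R}^n$, $u_k\in\mathbb{R}^m$, $y_k\in\mathbb{R}^p$, unknown matrices $(A,B,C,D)$, $(A,B)$ controllable and $(A,C)$ observable. Let $l\geq \underline{l}$ be an integer, where $\underline{l}$ is the lag of the system, and let $\xi_t=\begin{bmatrix}u_{[t-l,t-1]}\\ y_{[t-l,t-1]}\end{bmatrix}\in\mathbb{R}^{n_\xi}$, $n_\xi=(m+p)l$, be the extended state, which evolves according to the extended dynamics $\xi_{k+1}=\tilde A\xi_k+\tilde Bu_k$, $y_k=\tilde C\xi_k+\tilde Du_k$ described in the context. Let $\{u_k^d,y_k^d\}_{k=0}^{N-1}$ be an input-output trajectory of the system, let $\mathbb{U}\subseteq\mathbb{R}^m$, $\mathbb{Y}\subseteq\mathbb{R}^p$ be constraint sets, let $(u^s,y^s)\in\mathrm{int}(\mathbb{U}\times\mathbb{Y})$ be an equilibrium of the system with corresponding extended steady state $\xi^s=\begin{bmatrix}u^s\\ \vdots\\ u^s\\ y^s\\ \vdots\\ y^s\end{bmatrix}$, let $Q\succ0$, $R\succ0$, and let $L\in\mathbb{I}_{\geq1}$. Suppose that: (A1) there exist $P=P^\top\succ0$, $K\in\mathbb{R}^{m\times n_\xi}$ and a set $\Xi_f\subseteq\mathbb{U}^l\times\mathbb{Y}^l$ with $\xi^s\in\mathrm{int}(\Xi_f)$ such that for all $\xi\in\Xi_f$, with $u=u^s+K(\xi-\xi^s)$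 and $y=\tilde C\xi+\tilde Du$, we have (i) $\tilde A\xi+\tilde Bu\in\Xi_f$; (ii) $u\in\mathbb{U}$ and $y\in\mathbb{Y}$; (iii) $\lVert(\tilde A+\tilde BK)(\xi-\xi^s)\rVert_P^2\leq\lVert\xi-\xi^s\rVert_P^2-\lVert\xi-\xi^s\rVert_{K^\top RK}^2-\lVert y-y^s\rVert_Q^2$; (A2) there exists $c_u>0$ such that $J_L^*(\xi)\leq c_u\lVert\xi-\xi^s\rVert_2^2$ for all $\xi$ for which the optimal control problem below is feasible; (A3) the input $u^d$ is persistently exciting of order $L+l+n$. At each time $t\in\mathbb{I}_{\geq0}$, given the past $l$ closed-loop measurements $u_{[t-l,t-1]}$, $y_{[t-l,t-1]}$ (i.e., $\xi_t$), solve $$\min_{\alpha(t),\bar u(t),\bar y(t)}\ \sum_{k=0}^{L-1}\Big(\lVert\bar u_k(t)-u^s\rVert_R^2+\lVert\bar y_k(t)-y^s\rVert_Q^2\Big)+\lVert\bar\xi_L(t)-\xi^s\rVert_P^2$$ subject to $\begin{bmatrix}\bar u_{[-l,L-1]}(t)\\ \bar y_{[-l,L-1]}(t)\end{bmatrix}=\begin{bmatrix}H_{L+l}(u^d)\\ H_{L+l}(y^d)\end{bmatrix}\alpha(t)$, $\ \begin{bmatrix}\bar u_{[-l,-1]}(t)\\ \bar y_{[-l,-1]}(t)\end{bmatrix}=\begin{bmatrix}u_{[t-l,t-1]}\\ y_{[t-l,t-1]}\end{bmatrix}$, $\ \bar\xi_L(t)=\begin{bmatrix}\bar u_{[L-l,L-1]}(t)\\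 \bar y_{[L-l,L-1]}(t)\end{bmatrix}\in\Xi_f$, and $\bar u_k(t)\in\mathbb{U}$, $\bar y_k(t)\in\mathbb{Y}$ for $k\in\mathbb{I}_{[0,L-1]}$, and apply $u_t=\bar u_0^*(t)$, where $\bar u^*(t)$ is an optimal solution; $J_L^*(\xi_t)$ denotes the optimal value. If this problem is feasible at the initial time $t=0$, then (i) it is feasible at every $t\in\mathbb{I}_{\geq0}$; (ii) the closed-loop trajectory satisfies $u_t\in\mathbb{U}$ and $y_t\in\mathbb{Y}$ for all $t\in\mathbb{I}_{\geq0}$; (iii) the equilibrium $\xi^s$ is exponentially stable for the resulting closed loop (in the extended state $\xi_t$).
   Context: Notation: $\mathbb{I}_{[a,b]}$ is the set of integers in $[a,b]$, $\mathbb{I}_{\geq0}$ the nonnegative integers; $\lVert x\rVert_P^2=x^\top Px$. For a sequence $\{x_k\}_{k=0}^{N-1}$, $x_{[a,b]}=\begin{bmatrix}x_a^\top&\dots&x_b^\top\end{bmatrix}^\top$ and $x=x_{[0,N-1]}$. The Hankel matrix of depth $L$ is $H_L(x)=\begin{bmatrix}x_0&x_1&\dots&x_{N-L}\\ x_1&x_2&\dots&x_{N-L+1}\\ \vdots&&&\vdots\\ x_{L-1}&x_L&\dots&x_{N-1}\end{bmatrix}$. A sequence $\{u_k,y_k\}$ is a trajectory of the system if there is an initial state $x_0$ such that the system equations hold. $\{u_k\}_{k=0}^{N-1}$, $u_k\in\mathbb{R}^m$, is persistently exciting of order $L$ if $\mathrm{rank}(H_L(u))=mL$. The lag $\underline{l}$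 is the smallest $l\in\mathbb{I}_{[1,n]}$ such that $\Phi_l=\begin{bmatrix}C^\top&(CA)^\top&\dots&(CA^{l-1})^\top\end{bmatrix}^\top$ has rank $n$. $(u^s,y^s)$ is an equilibrium if the constant sequence $(\bar u_k,\bar y_k)=(u^s,y^s)$, $k\in\mathbb{I}_{[0,\underline{l}]}$, is a trajectory of the system. Extended dynamics: for $l\geq\underline{l}$ there exist matrices $G_1,\dots,G_l\in\mathbb{R}^{p\times m}$, $F_1,\dots,F_l\in\mathbb{R}^{p\times p}$ such that every trajectory satisfies $y_k=\sum_{i=1}^l G_iu_{k-i}+\sum_{i=1}^l F_iy_{k-i}+Du_k$; correspondingly $\xi_{k+1}=\tilde A\xi_k+\tilde Bu_k$, $y_k=\tilde C\xi_k+\tilde Du_k$, where $\tilde A$ shifts the input blocks and output blocks of $\xi_k$ up by one (dropping $u_{k-l}$, $y_{k-l}$), sets the new last input block to $0$ and the new last output block to $\tilde C\xi_k$, with $\tilde C=\begin{bmatrix}G_l&\dots&G_1&F_l&\dots&F_1\end{bmatrix}$, $\tilde D=D$, and $\tilde B$ has $I$ in the last input block, $D$ in the last output block and zeros elsewhere. The closed-loop extended state is $\xi_t=\begin{bmatrix}u_{[t-l,t-1]}^\top& y_{[t-l,t-1]}^\top\end{bmatrix}^\top$. *)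

theory Defs
  imports Complex_Main "Jordan_Normal_Form.DL_Rank"
begin

definition mrank :: "real mat \<Rightarrow> nat" where
  "mrank M = vec_space.rank (dim_row M) M"

definition vnorm :: "real vec \<Rightarrow> real" where
  "vnorm x = sqrt (x \<bullet> x)"

definition qf :: "real mat \<Rightarrow> real vec \<Rightarrow> real" where
  "qf M x = x \<bullet> (M *\<^sub>v x)"

definition pos_def :: "nat \<Rightarrow> real mat \<Rightarrow> bool" where
  "pos_def d M \<longleftrightarrow> M \<in> carrier_mat d d \<and> transpose_mat M = M \<and>
     (\<forall>x \<in> carrier_vec d. x \<noteq> 0\<^sub>v d \<longrightarrow> x \<bullet> (M *\<^sub>v x) > 0)"

definition interior_pt :: "nat \<Rightarrow> real vec set \<Rightarrow> real vec \<Rightarrow> bool" where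
  "interior_pt d S x \<longleftrightarrow> x \<in> carrier_vec d \<and>
     (\<exists>e>0. \<forall>z \<in> carrier_vec d. vnorm (z - x) < e \<longrightarrow> z \<in> S)"

definition ctrb_mat :: "nat \<Rightarrow> nat \<Rightarrow> real mat \<Rightarrow> real mat \<Rightarrow> real mat" where
  "ctrb_mat n m A B = mat n (n * m) (\<lambda>(r, c). (A ^\<^sub>m (c div m) * B) $$ (r, c mod m))"

definition obsv_mat :: "nat \<Rightarrow> nat \<Rightarrow> nat \<Rightarrow> real mat \<Rightarrow> real mat \<Rightarrow> real mat" where
  "obsv_mat n p l A C = mat (p * l) n (\<lambda>(r, c). (C * A ^\<^sub>m (r div p)) $$ (r mod p, c))"

definition controllable :: "nat \<Rightarrow> nat \<Rightarrow> real mat \<Rightarrow> real mat \<Rightarrow> bool" where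
  "controllable n m A B \<longleftrightarrow> mrank (ctrb_mat n m A B) = n"

definition observable :: "nat \<Rightarrow> nat \<Rightarrow> real mat \<Rightarrow> real mat \<Rightarrow> bool" where
  "observable n p A C \<longleftrightarrow> mrank (obsv_mat n p n A C) = n"

definition lag :: "nat \<Rightarrow> nat \<Rightarrow> real mat \<Rightarrow> real mat \<Rightarrow> nat" where
  "lag n p A C = (LEAST l. 1 \<le> l \<and> l \<le> n \<and> mrank (obsv_mat n p l A C) = n)"

definition is_traj :: "nat \<Rightarrow> nat \<Rightarrow> real mat \<Rightarrow> real mat \<Rightarrow> real mat \<Rightarrow> real mat \<Rightarrow>
    nat \<Rightarrow> (nat \<Rightarrow> real vec) \<Rightarrow> (nat \<Rightarrow> real vec) \<Rightarrow> bool" where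
  "is_traj n m A B C D N u y \<longleftrightarrow>
     (\<exists>x. x 0 \<in> carrier_vec n \<and>
        (\<forall>k<N. u k \<in> carrier_vec m \<and> x (Suc k) = A *\<^sub>v x k + B *\<^sub>v u k \<and>
               y k = C *\<^sub>v x k + D *\<^sub>v u k))"

definition is_traj_inf :: "nat \<Rightarrow> nat \<Rightarrow> real mat \<Rightarrow> real mat \<Rightarrow> real mat \<Rightarrow> real mat \<Rightarrow>
    (nat \<Rightarrow> real vec) \<Rightarrow> (nat \<Rightarrow> real vec) \<Rightarrow> bool" where
  "is_traj_inf n m A B C D u y \<longleftrightarrow>
     (\<exists>x. x 0 \<in> carrier_vec n \<and>
        (\<forall>k. u k \<in> carrier_vec m \<and> x (Suc k) = A *\<^sub>v x k + B *\<^sub>v u k \<and>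
               y k = C *\<^sub>v x k + D *\<^sub>v u k))"

definition equilibrium :: "nat \<Rightarrow> nat \<Rightarrow> nat \<Rightarrow> real mat \<Rightarrow> real mat \<Rightarrow> real mat \<Rightarrow> real mat \<Rightarrow>
    real vec \<Rightarrow> real vec \<Rightarrow> bool" where
  "equilibrium n m p A B C D us ys \<longleftrightarrow> us \<in> carrier_vec m \<and> ys \<in> carrier_vec p \<and>
     is_traj n m A B C D (Suc (lag n p A C)) (\<lambda>_. us) (\<lambda>_. ys)"

definition stack :: "nat \<Rightarrow> nat \<Rightarrow> (nat \<Rightarrow> real vec) \<Rightarrow> real vec" where
  "stack q d w = vec (q * d) (\<lambda>r. w (r div q) $ (r mod q))"

definition hankel :: "nat \<Rightarrow> nat \<Rightarrow> nat \<Rightarrow> (nat \<Rightarrow> real vec) \<Rightarrow> real mat" where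
  "hankel q d N w = mat (q * d) (N - d + 1) (\<lambda>(r, c). w (r div q + c) $ (r mod q))"

definition pers_exc :: "nat \<Rightarrow> nat \<Rightarrow> nat \<Rightarrow> (nat \<Rightarrow> real vec) \<Rightarrow> bool" where
  "pers_exc q d N w \<longleftrightarrow> mrank (hankel q d N w) = q * d"

definition ext_state :: "nat \<Rightarrow> nat \<Rightarrow> nat \<Rightarrow> (nat \<Rightarrow> real vec) \<Rightarrow> (nat \<Rightarrow> real vec) \<Rightarrow> nat \<Rightarrow> real vec" where
  "ext_state m p l u y t = stack m l (\<lambda>j. u (t + j)) @\<^sub>v stack p l (\<lambda>j. y (t + j))"

definition ublock :: "nat \<Rightarrow> nat \<Rightarrow> real vec \<Rightarrow> nat \<Rightarrow> real vec" where
  "ublock m p xi j = vec m (\<lambda>a. xi $ (j * m + a))"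

definition yblock :: "nat \<Rightarrow> nat \<Rightarrow> nat \<Rightarrow> real vec \<Rightarrow> nat \<Rightarrow> real vec" where
  "yblock m p l xi j = vec p (\<lambda>b. xi $ (m * l + j * p + b))"

definition prod_constr :: "nat \<Rightarrow> nat \<Rightarrow> nat \<Rightarrow> real vec set \<Rightarrow> real vec set \<Rightarrow> real vec set" where
  "prod_constr m p l U Y = {xi \<in> carrier_vec ((m + p) * l).
      (\<forall>j<l. ublock m p xi j \<in> U \<and> yblock m p l xi j \<in> Y)}"

(* extended dynamics matrices; G i, F i for i = 1..l *)
definition Ct :: "nat \<Rightarrow> nat \<Rightarrow> nat \<Rightarrow> (nat \<Rightarrow> real mat) \<Rightarrow> (nat \<Rightarrow> real mat) \<Rightarrow> real mat" where
  "Ct m p l G F = mat p ((m + p) * l) (\<lambda>(b, c).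
      if c < m * l then G (l - c div m) $$ (b, c mod m)
      else F (l - (c - m * l) div p) $$ (b, (c - m * l) mod p))"

definition At :: "nat \<Rightarrow> nat \<Rightarrow> nat \<Rightarrow> (nat \<Rightarrow> real mat) \<Rightarrow> (nat \<Rightarrow> real mat) \<Rightarrow> real mat" where
  "At m p l G F = mat ((m + p) * l) ((m + p) * l) (\<lambda>(r, c).
      if r < m * l then
        (if r div m < l - 1 \<and> c = r + m then 1 else 0)
      else if (r - m * l) div p < l - 1 then
        (if c = r + p then 1 else 0)
      else Ct m p l G F $$ ((r - m * l) mod p, c))"

definition Bt :: "nat \<Rightarrow> nat \<Rightarrow> nat \<Rightarrow> real mat \<Rightarrow> real mat" where
  "Bt m p l D = mat ((m + p) * l) m (\<lambda>(r, c).
      if r < m * l then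
        (if r div m = l - 1 \<and> c = r mod m then 1 else 0)
      else if (r - m * l) div p = l - 1 then D $$ ((r - m * l) mod p, c)
      else 0)"

(* ---- the data-driven MPC optimal control problem ----
   A candidate solution is (alpha, ub, yb) where ub j, yb j (j < L + l) stand for
   \<bar>u_(j-l)(t), \<bar>y_(j-l)(t), i.e. index j corresponds to prediction time j - l. *)
definition ocp_feasible_sol ::
  "nat \<Rightarrow> nat \<Rightarrow> nat \<Rightarrow> nat \<Rightarrow> nat \<Rightarrow> (nat \<Rightarrow> real vec) \<Rightarrow> (nat \<Rightarrow> real vec) \<Rightarrow>
   real vec set \<Rightarrow> real vec set \<Rightarrow> real vec set \<Rightarrow> real vec \<Rightarrow>
   real vec \<Rightarrow> (nat \<Rightarrow> real vec) \<Rightarrow> (nat \<Rightarrow> real vec) \<Rightarrow> bool" where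
  "ocp_feasible_sol m p l L N ud yd U Y Xf xi alpha ub yb \<longleftrightarrow>
     alpha \<in> carrier_vec (N - (L + l) + 1) \<and>
     (\<forall>j < L + l. ub j \<in> carrier_vec m \<and> yb j \<in> carrier_vec p) \<and>
     stack m (L + l) ub = hankel m (L + l) N ud *\<^sub>v alpha \<and>
     stack p (L + l) yb = hankel p (L + l) N yd *\<^sub>v alpha \<and>
     ext_state m p l ub yb 0 = xi \<and>
     ext_state m p l ub yb L \<in> Xf \<and>
     (\<forall>k<L. ub (l + k) \<in> U \<and> yb (l + k) \<in> Y)"

definition ocp_cost ::
  "nat \<Rightarrow> nat \<Rightarrow> nat \<Rightarrow> nat \<Rightarrow> real mat \<Rightarrow> real mat \<Rightarrow> real mat \<Rightarrow>
   real vec \<Rightarrow> real vec \<Rightarrow> real vec \<Rightarrow>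
   (nat \<Rightarrow> real vec) \<Rightarrow> (nat \<Rightarrow> real vec) \<Rightarrow> real" where
  "ocp_cost m p l L Q R P us ys xis ub yb =
     (\<Sum>k<L. qf R (ub (l + k) - us) + qf Q (yb (l + k) - ys)) +
     qf P (ext_state m p l ub yb L - xis)"

definition ocp_feasible ::
  "nat \<Rightarrow> nat \<Rightarrow> nat \<Rightarrow> nat \<Rightarrow> nat \<Rightarrow> (nat \<Rightarrow> real vec) \<Rightarrow> (nat \<Rightarrow> real vec) \<Rightarrow>
   real vec set \<Rightarrow> real vec set \<Rightarrow> real vec set \<Rightarrow> real vec \<Rightarrow> bool" where
  "ocp_feasible m p l L N ud yd U Y Xf xi \<longleftrightarrow>
     (\<exists>alpha ub yb. ocp_feasible_sol m p l L N ud yd U Y Xf xi alpha ub yb)"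

definition ocp_value ::
  "nat \<Rightarrow> nat \<Rightarrow> nat \<Rightarrow> nat \<Rightarrow> nat \<Rightarrow> (nat \<Rightarrow> real vec) \<Rightarrow> (nat \<Rightarrow> real vec) \<Rightarrow>
   real vec set \<Rightarrow> real vec set \<Rightarrow> real vec set \<Rightarrow>
   real mat \<Rightarrow> real mat \<Rightarrow> real mat \<Rightarrow> real vec \<Rightarrow> real vec \<Rightarrow> real vec \<Rightarrow> real vec \<Rightarrow> real" where
  "ocp_value m p l L N ud yd U Y Xf Q R P us ys xis xi =
     Inf {ocp_cost m p l L Q R P us ys xis ub yb | alpha ub yb.
            ocp_feasible_sol m p l L N ud yd U Y Xf xi alpha ub yb}"

definition ocp_optimal_sol ::
  "nat \<Rightarrow> nat \<Rightarrow> nat \<Rightarrow> nat \<Rightarrow> nat \<Rightarrow> (nat \<Rightarrow> real vec) \<Rightarrow> (nat \<Rightarrow> real vec) \<Rightarrow>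
   real vec set \<Rightarrow> real vec set \<Rightarrow> real vec set \<Rightarrow>
   real mat \<Rightarrow> real mat \<Rightarrow> real mat \<Rightarrow> real vec \<Rightarrow> real vec \<Rightarrow> real vec \<Rightarrow> real vec \<Rightarrow>
   real vec \<Rightarrow> (nat \<Rightarrow> real vec) \<Rightarrow> (nat \<Rightarrow> real vec) \<Rightarrow> bool" where
  "ocp_optimal_sol m p l L N ud yd U Y Xf Q R P us ys xis xi alpha ub yb \<longleftrightarrow>
     ocp_feasible_sol m p l L N ud yd U Y Xf xi alpha ub yb \<and>
     (\<forall>alpha' ub' yb'. ocp_feasible_sol m p l L N ud yd U Y Xf xi alpha' ub' yb' \<longrightarrow>
        ocp_cost m p l L Q R P us ys xis ub yb \<le> ocp_cost m p l L Q R P us ys xis ub' yb')"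

end

theory Submission
  imports Defs
begin

text \<open>By Willems' fundamental lemma the Hankel constraint describes exactly the trajectories of
  length \<open>L + l\<close>. Hence the optimal prediction, shifted by one step and prolonged by the terminal
  controller, is feasible at the next time, and \<open>V\<^sub>t = J\<^sub>L\<^sup>*(\<xi>\<^sub>t)\<close> decreases by at least the stage
  cost. The stage cost bounds only the newest input-output pair of the extended state, so \<open>V\<^sub>t\<close>
  alone is not a strict Lyapunov function; adding a small multiple of the sum of the squared
  deviations of the last \<open>l\<close> pairs, weighted increasingly from the oldest to the newest, makes it
  one.

  For the fundamental lemma, let a linear functional of an initial state and \<open>d\<close> inputs vanish on
  all data windows. By persistency of excitation every trajectory is a combination of data windows
  plus a free response, so along every trajectory the values of the functional satisfy a monic
  linear recurrence of order \<open>n\<close>. They vanish along trajectories that start at rest, and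
  controllability forces the functional to be zero.\<close>

section \<open>Linear algebra\<close>

lemma (in vec_space) rank_obtain_indpt_cols:
  assumes A: "A \<in> carrier_mat n nc"
  obtains S where "S \<subseteq> set (cols A)" "lin_indpt S" "card S = rank A"
proof -
  obtain S where S: "maximal S (\<lambda>T. T \<subseteq> set (cols A) \<and> lin_indpt T)"
    using maximal_exists[of "\<lambda>T. T \<subseteq> set (cols A) \<and> lin_indpt T" "card (set (cols A))" "{}"]
    by (meson List.finite_set card_mono empty_iff empty_subsetI finite_lin_indpt2 rev_finite_subset)
  then show ?thesis using that rank_card_indpt[OF A S] by (auto simp: maximal_def)
qed

lemma (in vec_space) full_row_rank_imp_surj:
  assumes A: "A \<in> carrier_mat n nc" and rank: "rank A = n" and b: "b \<in> carrier_vec n"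
  obtains x where "x \<in> carrier_vec nc" "A *\<^sub>v x = b"
proof -
  have cols: "set (cols A) \<subseteq> carrier_vec n" using cols_dim A by blast
  obtain S where sub: "S \<subseteq> set (cols A)" and indpt: "lin_indpt S" and card: "card S = rank A"
    using rank_obtain_indpt_cols[OF A] .
  have "basis S"
    using sub indpt cols card rank
    by (intro dim_li_is_basis) (auto simp: dim_is_n intro: finite_subset)
  then have "carrier_vec n \<subseteq> col_space A"
    using span_is_monotone[OF sub] by (simp add: basis_def col_space_def)
  then show ?thesis using b that A by (auto simp: col_space_eq[OF A])
qed

lemma (in vec_space) full_col_rank_imp_inj:
  assumes A: "A \<in> carrier_mat n nc" and rank: "rank A = nc"
    and v: "v \<in> carrier_vec nc" and Av: "A *\<^sub>v v = 0\<^sub>v n"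
  shows "v = 0\<^sub>v nc"
proof -
  obtain S where sub: "S \<subseteq> set (cols A)" and indpt: "lin_indpt S" and card: "card S = rank A"
    using rank_obtain_indpt_cols[OF A] .
  have "card S = length (cols A)" using card rank A by simp
  moreover have "card S \<le> card (set (cols A))" using sub by (simp add: card_mono)
  ultimately have "distinct (cols A)" "S = set (cols A)"
    using card_length[of "cols A"] card_distinct[of "cols A"] card_subset_eq[OF List.finite_set sub]
    by auto
  then show ?thesis using lin_depI[OF A v _ Av] indpt by blast
qed

lemma full_row_rank_imp_left_kernel_trivial:
  fixes M :: "'a :: field mat"
  assumes M: "M \<in> carrier_mat r c" and rank: "vec_space.rank r M = r"
    and v: "v \<in> carrier_vec r" and kernel: "M\<^sup>T *\<^sub>v v = 0\<^sub>v c"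
  shows "v = 0\<^sub>v r"
proof (rule eq_vecI)
  fix i assume "i < dim_vec (0\<^sub>v r :: 'a vec)"
  then have i: "i < r" by simp
  obtain x where x: "x \<in> carrier_vec c" "M *\<^sub>v x = unit_vec r i"
    using vec_space.full_row_rank_imp_surj[OF M rank unit_vec_carrier] by blast
  have "v $ i = v \<bullet> (M *\<^sub>v x)" using x(2) i v by simp
  also have "\<dots> = (M\<^sup>T *\<^sub>v v) \<bullet> x" using transpose_vec_mult_scalar[OF M x(1) v] by simp
  finally show "v $ i = 0\<^sub>v r $ i" using kernel x(1) i by simp
qed (use v in simp)

lemma left_kernel_trivial_imp_surj:
  fixes M :: "real mat"
  assumes M: "M \<in> carrier_mat r c"
    and kernel: "\<And>v. v \<in> carrier_vec r \<Longrightarrow> M\<^sup>T *\<^sub>v v = 0\<^sub>v c \<Longrightarrow> v = 0\<^sub>v r"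
    and b: "b \<in> carrier_vec r"
  obtains x where "x \<in> carrier_vec c" "M *\<^sub>v x = b"
proof -
  have MT: "M\<^sup>T \<in> carrier_mat c r" and Gram: "M * M\<^sup>T \<in> carrier_mat r r" using M by simp_all
  have "v = 0\<^sub>v r" if v: "v \<in> carrier_vec r" and z: "(M * M\<^sup>T) *\<^sub>v v = 0\<^sub>v r" for v
  proof (rule kernel[OF v])
    have "(M\<^sup>T *\<^sub>v v) \<bullet> (M\<^sup>T *\<^sub>v v) = (M *\<^sub>v (M\<^sup>T *\<^sub>v v)) \<bullet> v"
      using transpose_vec_mult_scalar[OF MT v mult_mat_vec_carrier[OF MT v]] by simp
    also have "M *\<^sub>v (M\<^sup>T *\<^sub>v v) = 0\<^sub>v r"
      using z assoc_mult_mat_vec[OF M MT v] by simp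
    finally show "M\<^sup>T *\<^sub>v v = 0\<^sub>v c"
      using conjugate_square_eq_0_vec[OF mult_mat_vec_carrier[OF MT v]] v by simp
  qed
  then have "det (M * M\<^sup>T) \<noteq> 0" using det_0_iff_vec_prod_zero_field[OF Gram] by blast
  then have "vec_space.rank r (M * M\<^sup>T) = r" using vec_space.det_rank_iff[OF Gram] by blast
  then obtain w where w: "w \<in> carrier_vec r" "(M * M\<^sup>T) *\<^sub>v w = b"
    using vec_space.full_row_rank_imp_surj[OF Gram _ b] by blast
  then show ?thesis
    using that[of "M\<^sup>T *\<^sub>v w"] assoc_mult_mat_vec[OF M MT w(1)]
      mult_mat_vec_carrier[OF MT w(1)]
    by simp
qed

lemma wide_mat_kernel_nontrivial:
  fixes M :: "'a :: field mat"
  assumes M: "M \<in> carrier_mat r c" and "r < c"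
  obtains v where "v \<in> carrier_vec c" "v \<noteq> 0\<^sub>v c" "M *\<^sub>v v = 0\<^sub>v r"
proof -
  let ?N = "mat c c (\<lambda>(i, j). if i < r then M $$ (i, j) else 0)"
  have N: "?N \<in> carrier_mat c c" by simp
  have "det ?N = (\<Sum>j<c. ?N $$ (r, j) * cofactor ?N r j)"
    using laplace_expansion_row[OF N \<open>r < c\<close>] .
  also have "\<dots> = 0" using \<open>r < c\<close> by simp
  finally obtain v where v: "v \<in> carrier_vec c" "v \<noteq> 0\<^sub>v c" "?N *\<^sub>v v = 0\<^sub>v c"
    using det_0_iff_vec_prod_zero_field[OF N] by blast
  have "M *\<^sub>v v = 0\<^sub>v r"
  proof (rule eq_vecI)
    fix i assume "i < dim_vec (0\<^sub>v r :: 'a vec)"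
    then have i: "i < r" by simp
    then have "row M i = row ?N i" using M \<open>r < c\<close> by (intro eq_vecI) auto
    then have "(M *\<^sub>v v) $ i = (?N *\<^sub>v v) $ i" using M i \<open>r < c\<close> by simp
    then show "(M *\<^sub>v v) $ i = 0\<^sub>v r $ i" using v(3) i \<open>r < c\<close> by simp
  qed (use M in simp)
  then show ?thesis using that v by blast
qed

lemma vec_minus_eq_0_iff:
  fixes v w :: "'a :: group_add vec"
  assumes "v \<in> carrier_vec n" "w \<in> carrier_vec n"
  shows "v - w = 0\<^sub>v n \<longleftrightarrow> v = w"
  using assms by (auto simp: vec_eq_iff)

lemma mult_mat_zero_vec: "M \<in> carrier_mat r c \<Longrightarrow> M *\<^sub>v 0\<^sub>v c = 0\<^sub>v r"
  by (intro eq_vecI) auto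

lemma feedback_deviation:
  fixes A B K :: "'a :: comm_ring mat"
  assumes A: "A \<in> carrier_mat d d" and B: "B \<in> carrier_mat d m" and K: "K \<in> carrier_mat m d"
    and x: "x \<in> carrier_vec d" and xs: "xs \<in> carrier_vec d" and us: "us \<in> carrier_vec m"
    and steady: "A *\<^sub>v xs + B *\<^sub>v us = xs"
  shows "A *\<^sub>v x + B *\<^sub>v (us + K *\<^sub>v (x - xs)) - xs = (A + B * K) *\<^sub>v (x - xs)"
proof -
  have dev: "x - xs \<in> carrier_vec d" using x xs by simp
  have Kdev: "K *\<^sub>v (x - xs) \<in> carrier_vec m" by (rule mult_mat_vec_carrier[OF K dev])
  have "(A + B * K) *\<^sub>v (x - xs) = (A *\<^sub>v x - A *\<^sub>v xs) + B *\<^sub>v (K *\<^sub>v (x - xs))"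
    using add_mult_distrib_mat_vec[OF A mult_carrier_mat[OF B K] dev]
      assoc_mult_mat_vec[OF B K dev] mult_minus_distrib_mat_vec[OF A x xs] by simp
  also have "\<dots> = (A *\<^sub>v x + (B *\<^sub>v us + B *\<^sub>v (K *\<^sub>v (x - xs)))) - (A *\<^sub>v xs + B *\<^sub>v us)"
    using A B by (intro eq_vecI) (simp_all del: index_mult_mat_vec)
  also have "\<dots> = A *\<^sub>v x + B *\<^sub>v (us + K *\<^sub>v (x - xs)) - xs"
    using mult_add_distrib_mat_vec[OF B us Kdev] steady by simp
  finally show ?thesis ..
qed

lemma pow_mat_add:
  assumes A: "A \<in> carrier_mat n n"
  shows "A ^\<^sub>m (i + j) = A ^\<^sub>m i * A ^\<^sub>m j"
proof (induction j)
  case (Suc j)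
  then show ?case
    using assoc_mult_mat[OF pow_carrier_mat[OF A, of i] pow_carrier_mat[OF A, of j] A] by simp
qed (use pow_carrier_mat[OF A, of i] A in simp)

lemma pow_mat_Suc_mult_vec:
  assumes A: "A \<in> carrier_mat n n" and v: "v \<in> carrier_vec n"
  shows "A ^\<^sub>m Suc i *\<^sub>v v = A *\<^sub>v (A ^\<^sub>m i *\<^sub>v v)"
  using pow_mat_add[OF A, of 1 i] A assoc_mult_mat_vec[OF A pow_carrier_mat[OF A, of i] v] by simp

definition window_mat :: "nat \<Rightarrow> nat \<Rightarrow> (nat \<Rightarrow> 'a vec) \<Rightarrow> nat \<Rightarrow> 'a mat" where
  "window_mat q M w j = mat q M (\<lambda>(i, c). w (j + c) $ i)"

lemma window_mat_carrier [simp]: "window_mat q M w j \<in> carrier_mat q M"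
  by (simp add: window_mat_def)

lemma window_mat_mult_carrier [simp]: "window_mat q M w j *\<^sub>v v \<in> carrier_vec q"
  by (rule carrier_vecI) (simp add: window_mat_def)

lemma scalar_prod_window_mat:
  fixes w :: "nat \<Rightarrow> 'a :: comm_semiring_0 vec"
  assumes \<alpha>: "\<alpha> \<in> carrier_vec M" and w: "\<And>c. c < M \<Longrightarrow> w (j + c) \<in> carrier_vec q"
  shows "v \<bullet> (window_mat q M w j *\<^sub>v \<alpha>) = (\<Sum>c<M. \<alpha> $ c * (v \<bullet> w (j + c)))"
proof -
  have "v \<bullet> (window_mat q M w j *\<^sub>v \<alpha>) = (\<Sum>i<q. \<Sum>c<M. \<alpha> $ c * (v $ i * w (j + c) $ i))"
    using \<alpha> by (simp add: window_mat_def scalar_prod_def atLeast0LessThan sum_distrib_left mult_ac)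
  also have "\<dots> = (\<Sum>c<M. \<Sum>i<q. \<alpha> $ c * (v $ i * w (j + c) $ i))" by (rule sum.swap)
  also have "\<dots> = (\<Sum>c<M. \<alpha> $ c * (v \<bullet> w (j + c)))"
    by (rule sum.cong)
      (simp_all add: scalar_prod_def atLeast0LessThan sum_distrib_left carrier_vecD[OF w])
  finally show ?thesis .
qed

lemma window_mat_affine:
  fixes A :: "'a :: comm_semiring_0 mat"
  assumes A: "A \<in> carrier_mat q n" and B: "B \<in> carrier_mat q m" and \<alpha>: "\<alpha> \<in> carrier_vec M"
    and w: "\<And>c. c < M \<Longrightarrow> w (i + c) = A *\<^sub>v x (j + c) + B *\<^sub>v u (j + c)"
    and x: "\<And>c. c < M \<Longrightarrow> x (j + c) \<in> carrier_vec n" and u: "\<And>c. c < M \<Longrightarrow> u (j + c) \<in> carrier_vec m"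
  shows "window_mat q M w i *\<^sub>v \<alpha>
    = A *\<^sub>v (window_mat n M x j *\<^sub>v \<alpha>) + B *\<^sub>v (window_mat m M u j *\<^sub>v \<alpha>)"
proof (rule eq_vecI)
  let ?x = "window_mat n M x j *\<^sub>v \<alpha>" and ?u = "window_mat m M u j *\<^sub>v \<alpha>"
  fix r assume "r < dim_vec (A *\<^sub>v ?x + B *\<^sub>v ?u)"
  then have r: "r < q" using B by simp
  have "(A *\<^sub>v ?x + B *\<^sub>v ?u) $ r = row A r \<bullet> ?x + row B r \<bullet> ?u" using r A B by simp
  also have "\<dots> = (\<Sum>c<M. \<alpha> $ c * (row A r \<bullet> x (j + c) + row B r \<bullet> u (j + c)))"
    by (simp add: scalar_prod_window_mat[where w = x and j = j, OF \<alpha> x]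
        scalar_prod_window_mat[where w = u and j = j, OF \<alpha> u] sum.distrib distrib_left)
  also have "\<dots> = (\<Sum>c<M. \<alpha> $ c * w (i + c) $ r)" using w r A B by simp
  also have "\<dots> = (window_mat q M w i *\<^sub>v \<alpha>) $ r"
    using r \<alpha> by (simp add: window_mat_def scalar_prod_def atLeast0LessThan mult.commute)
  finally show "(window_mat q M w i *\<^sub>v \<alpha>) $ r = (A *\<^sub>v ?x + B *\<^sub>v ?u) $ r" ..
qed (use B in \<open>simp add: window_mat_def\<close>)

lemma pow_mat_annihilator:
  fixes A :: "'a :: field mat"
  assumes A: "A \<in> carrier_mat n n" and \<xi>: "\<xi> \<in> carrier_vec n"
  obtains b j where "j \<le> n" "b j \<noteq> 0"
    "\<And>v. v \<in> carrier_vec n \<Longrightarrow> (\<Sum>j\<le>n. b j * (\<xi> \<bullet> (A ^\<^sub>m j *\<^sub>v v))) = 0"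
proof -
  define w where "w j = (A ^\<^sub>m j)\<^sup>T *\<^sub>v \<xi>" for j
  have pow: "A ^\<^sub>m j \<in> carrier_mat n n" for j using A by (rule pow_carrier_mat)
  have w: "w j \<in> carrier_vec n" for j
    unfolding w_def using pow \<xi> by (metis mult_mat_vec_carrier transpose_carrier_mat)
  obtain b where b: "b \<in> carrier_vec (Suc n)" "b \<noteq> 0\<^sub>v (Suc n)"
    "window_mat n (Suc n) w 0 *\<^sub>v b = 0\<^sub>v n"
    using wide_mat_kernel_nontrivial[OF window_mat_carrier lessI] by blast
  have "(\<Sum>j\<le>n. b $ j * (\<xi> \<bullet> (A ^\<^sub>m j *\<^sub>v v))) = 0" if v: "v \<in> carrier_vec n" for v
  proof -
    have "\<xi> \<bullet> (A ^\<^sub>m j *\<^sub>v v) = v \<bullet> w j" for j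
      using transpose_vec_mult_scalar[OF pow v \<xi>, of j] comm_scalar_prod[OF v w]
      by (simp add: w_def)
    then have "(\<Sum>j\<le>n. b $ j * (\<xi> \<bullet> (A ^\<^sub>m j *\<^sub>v v))) = v \<bullet> (window_mat n (Suc n) w 0 *\<^sub>v b)"
      using scalar_prod_window_mat[OF b(1), of w 0 n v] w by (simp add: lessThan_Suc_atMost)
    then show ?thesis using b(3) v by simp
  qed
  moreover obtain j where "j \<le> n" "b $ j \<noteq> 0"
    using b(1,2) by (auto simp: vec_eq_iff less_Suc_eq_le)
  ultimately show ?thesis using that by blast
qed

text \<open>This replaces the Cayley-Hamilton theorem: only one row vector has to be annihilated.\<close>
lemma pow_mat_monic_annihilator:
  fixes A :: "'a :: field mat"
  assumes A: "A \<in> carrier_mat n n" and \<xi>: "\<xi> \<in> carrier_vec n"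
  obtains a where "a n = 1" "\<And>v. v \<in> carrier_vec n \<Longrightarrow> (\<Sum>j\<le>n. a j * (\<xi> \<bullet> (A ^\<^sub>m j *\<^sub>v v))) = 0"
proof -
  have pow: "A ^\<^sub>m j \<in> carrier_mat n n" for j using A by (rule pow_carrier_mat)
  obtain b j where "j \<le> n" "b j \<noteq> 0"
    and b: "\<And>v. v \<in> carrier_vec n \<Longrightarrow> (\<Sum>j\<le>n. b j * (\<xi> \<bullet> (A ^\<^sub>m j *\<^sub>v v))) = 0"
    using pow_mat_annihilator[OF A \<xi>] by metis
  define r where "r = Max {j. j \<le> n \<and> b j \<noteq> 0}"
  have "r \<in> {j. j \<le> n \<and> b j \<noteq> 0}"
    unfolding r_def by (rule Max_in) (use \<open>j \<le> n\<close> \<open>b j \<noteq> 0\<close> in auto)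
  then have r: "r \<le> n" "b r \<noteq> 0" by simp_all
  have above_r: "b j = 0" if "r < j" "j \<le> n" for j
    using that Max_ge[of "{j. j \<le> n \<and> b j \<noteq> 0}" j] unfolding r_def by fastforce
  define a where "a j = (if j < n - r then 0 else b (j - (n - r)) / b r)" for j
  have "(\<Sum>j\<le>n. a j * (\<xi> \<bullet> (A ^\<^sub>m j *\<^sub>v v))) = 0" if v: "v \<in> carrier_vec n" for v
  proof -
    have "(\<Sum>j\<le>n. a j * (\<xi> \<bullet> (A ^\<^sub>m j *\<^sub>v v))) = (\<Sum>j\<in>{n - r..n}. a j * (\<xi> \<bullet> (A ^\<^sub>m j *\<^sub>v v)))"
      by (intro sum.mono_neutral_right) (auto simp: a_def)
    also have "\<dots> = (\<Sum>j\<le>r. a (j + (n - r)) * (\<xi> \<bullet> (A ^\<^sub>m (j + (n - r)) *\<^sub>v v)))"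
      using r(1) by (intro sum.reindex_bij_witness[of _ "\<lambda>j. j + (n - r)" "\<lambda>j. j - (n - r)"]) auto
    also have "\<dots> = (\<Sum>j\<le>r. b j * (\<xi> \<bullet> (A ^\<^sub>m j *\<^sub>v (A ^\<^sub>m (n - r) *\<^sub>v v)))) / b r"
      using assoc_mult_mat_vec[OF pow pow v]
      by (simp add: a_def pow_mat_add[OF A] sum_divide_distrib)
    also have "(\<Sum>j\<le>r. b j * (\<xi> \<bullet> (A ^\<^sub>m j *\<^sub>v (A ^\<^sub>m (n - r) *\<^sub>v v))))
        = (\<Sum>j\<le>n. b j * (\<xi> \<bullet> (A ^\<^sub>m j *\<^sub>v (A ^\<^sub>m (n - r) *\<^sub>v v))))"
      using r(1) above_r by (intro sum.mono_neutral_left) auto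
    finally show ?thesis using b[OF mult_mat_vec_carrier[OF pow v]] by simp
  qed
  moreover have "a n = 1" using r by (simp add: a_def)
  ultimately show ?thesis using that by blast
qed

lemma linear_recurrence_eq_0:
  fixes a s :: "nat \<Rightarrow> 'a :: semiring_1"
  assumes monic: "a n = 1" and recurrence: "\<And>k. (\<Sum>j\<le>n. a j * s (k + j)) = 0"
    and initial: "\<And>k. k < n \<Longrightarrow> s k = 0"
  shows "s k = 0"
proof (induction k rule: less_induct)
  case (less k)
  show ?case
  proof (cases "k < n")
    case False
    then have "(\<Sum>j<n. a j * s (k - n + j)) = 0" using less by simp
    then show ?thesis
      using recurrence[of "k - n"] False monic by (simp flip: lessThan_Suc_atMost)
  qed (rule initial)
qed

section \<open>Linear systems and their trajectories\<close>

locale lti_system =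
  fixes n m p :: nat and A B C D :: "real mat"
  assumes A: "A \<in> carrier_mat n n" and B: "B \<in> carrier_mat n m"
    and C: "C \<in> carrier_mat p n" and D: "D \<in> carrier_mat p m"
begin

abbreviation "trajectory \<equiv> is_traj n m A B C D"

primrec state :: "real vec \<Rightarrow> (nat \<Rightarrow> real vec) \<Rightarrow> nat \<Rightarrow> real vec" where
  "state x u 0 = x"
| "state x u (Suc k) = A *\<^sub>v state x u k + B *\<^sub>v u k"

definition response :: "real vec \<Rightarrow> (nat \<Rightarrow> real vec) \<Rightarrow> nat \<Rightarrow> real vec" where
  "response x u k = C *\<^sub>v state x u k + D *\<^sub>v u k"

lemma state_carrier:
  "x \<in> carrier_vec n \<Longrightarrow> (\<And>j. j < k \<Longrightarrow> u j \<in> carrier_vec m) \<Longrightarrow> state x u k \<in> carrier_vec n"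
  by (induction k) (use A B in auto)

lemma response_carrier:
  "x \<in> carrier_vec n \<Longrightarrow> (\<And>j. j \<le> k \<Longrightarrow> u j \<in> carrier_vec m) \<Longrightarrow> response x u k \<in> carrier_vec p"
  using state_carrier[of x k u] C D by (simp add: response_def)

lemma state_cong: "(\<And>j. j < k \<Longrightarrow> u j = u' j) \<Longrightarrow> state x u k = state x u' k"
  by (induction k) auto

lemma state_add: "state x u (s + k) = state (state x u s) (\<lambda>j. u (s + j)) k"
  by (induction k) auto

lemma state_minus:
  assumes x: "x \<in> carrier_vec n" "x' \<in> carrier_vec n"
    and u: "\<And>j. j < k \<Longrightarrow> u j \<in> carrier_vec m" "\<And>j. j < k \<Longrightarrow> u' j \<in> carrier_vec m"
  shows "state (x - x') (\<lambda>j. u j - u' j) k = state x u k - state x' u' k"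
  using u
proof (induction k)
  case (Suc k)
  have xk: "state x u k \<in> carrier_vec n" "state x' u' k \<in> carrier_vec n"
    using x Suc.prems by (auto intro: state_carrier)
  have uk: "u k \<in> carrier_vec m" "u' k \<in> carrier_vec m" using Suc.prems by auto
  have "state (x - x') (\<lambda>j. u j - u' j) (Suc k) =
      (A *\<^sub>v state x u k - A *\<^sub>v state x' u' k) + (B *\<^sub>v u k - B *\<^sub>v u' k)"
    using Suc by (simp add: mult_minus_distrib_mat_vec[OF A xk] mult_minus_distrib_mat_vec[OF B uk])
  also have "\<dots> = state x u (Suc k) - state x' u' (Suc k)"
    using A B xk uk by (intro eq_vecI) auto
  finally show ?case .
qed simp

lemma state_zero_input: "x \<in> carrier_vec n \<Longrightarrow> state x (\<lambda>_. 0\<^sub>v m) k = A ^\<^sub>m k *\<^sub>v x"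
proof (induction k)
  case (Suc k)
  then show ?case
    using mult_mat_vec_carrier[OF A mult_mat_vec_carrier[OF pow_carrier_mat[OF A]]]
    by (simp add: pow_mat_Suc_mult_vec[OF A] mult_mat_zero_vec[OF B] del: pow_mat.simps)
qed (use A in simp)

lemma state_zero: "(\<And>j. j < k \<Longrightarrow> u j = 0\<^sub>v m) \<Longrightarrow> state (0\<^sub>v n) u k = 0\<^sub>v n"
  by (induction k) (simp_all add: mult_mat_zero_vec[OF A] mult_mat_zero_vec[OF B])

lemma state_eq_plus_free_response:
  assumes x: "x \<in> carrier_vec n" and z: "z \<in> carrier_vec n"
    and u: "\<And>j. j < k \<Longrightarrow> u j \<in> carrier_vec m"
  shows "state x u k = state z u k + A ^\<^sub>m k *\<^sub>v (x - z)"
proof -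
  have "A ^\<^sub>m k *\<^sub>v (x - z) = state (x - z) (\<lambda>j. u j - u j) k"
    using x z state_cong[of k "\<lambda>_. 0\<^sub>v m" "\<lambda>j. u j - u j"] state_zero_input[of "x - z" k]
    by (simp add: minus_cancel_vec[OF u])
  also have "\<dots> = state x u k - state z u k" using x z u by (intro state_minus) auto
  finally show ?thesis
    using state_carrier[of x k u, OF x u] state_carrier[of z k u, OF z u] by (intro eq_vecI) auto
qed

lemma state_impulse:
  assumes v: "v \<in> carrier_vec m"
  shows "state (0\<^sub>v n) (\<lambda>k. if k = s then v else 0\<^sub>v m) (Suc s + k) = A ^\<^sub>m k *\<^sub>v (B *\<^sub>v v)"
proof -
  let ?u = "\<lambda>k. if k = s then v else 0\<^sub>v m"
  have "state (0\<^sub>v n) ?u (Suc s) = B *\<^sub>v v"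
    using state_zero[of s ?u] B v by (simp add: mult_mat_zero_vec[OF A])
  then show ?thesis
    using state_add[of "0\<^sub>v n" ?u "Suc s" k] state_zero_input[of "B *\<^sub>v v" k] B v by simp
qed

lemma trajectory_iff:
  "trajectory N u y \<longleftrightarrow>
    (\<exists>x\<in>carrier_vec n. \<forall>k<N. u k \<in> carrier_vec m \<and> y k = response x u k)"
proof
  assume "trajectory N u y"
  then obtain x where x0: "x 0 \<in> carrier_vec n" and u: "\<And>k. k < N \<Longrightarrow> u k \<in> carrier_vec m"
    and x: "\<And>k. k < N \<Longrightarrow> x (Suc k) = A *\<^sub>v x k + B *\<^sub>v u k"
    and y: "\<And>k. k < N \<Longrightarrow> y k = C *\<^sub>v x k + D *\<^sub>v u k"
    unfolding is_traj_def by blast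
  have state: "state (x 0) u k = x k" if "k \<le> N" for k
    using that by (induction k) (simp_all add: x)
  show "\<exists>x\<in>carrier_vec n. \<forall>k<N. u k \<in> carrier_vec m \<and> y k = response x u k"
    using x0 u y by (intro bexI[of _ "x 0"]) (auto simp: response_def state)
next
  assume "\<exists>x\<in>carrier_vec n. \<forall>k<N. u k \<in> carrier_vec m \<and> y k = response x u k"
  then obtain x where "x \<in> carrier_vec n" "\<forall>k<N. u k \<in> carrier_vec m \<and> y k = response x u k"
    by blast
  then show "trajectory N u y"
    unfolding is_traj_def by (intro exI[of _ "state x u"]) (simp add: response_def)
qed

lemma trajectory_carrier:
  assumes "trajectory N u y" "k < N"
  shows "u k \<in> carrier_vec m" and "y k \<in> carrier_vec p"
  using assms response_carrier[of _ k u] unfolding trajectory_iff by auto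

lemma trajectory_shift:
  assumes "trajectory (s + N) u y"
  shows "trajectory N (\<lambda>k. u (s + k)) (\<lambda>k. y (s + k))"
proof -
  obtain x where x: "x \<in> carrier_vec n"
    and uy: "\<And>k. k < s + N \<Longrightarrow> u k \<in> carrier_vec m \<and> y k = response x u k"
    using assms unfolding trajectory_iff by blast
  have "state x u s \<in> carrier_vec n" using x uy by (auto intro: state_carrier)
  then show ?thesis
    unfolding trajectory_iff using uy
    by (intro bexI[of _ "state x u s"]) (auto simp: response_def state_add)
qed

lemma trajectory_append:
  assumes "trajectory N u y" and v: "v \<in> carrier_vec m"
  obtains w where "trajectory (Suc N) (u(N := v)) (y(N := w))"
proof -
  obtain x where x: "x \<in> carrier_vec n"
    and uy: "\<And>k. k < N \<Longrightarrow> u k \<in> carrier_vec m \<and> y k = response x u k"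
    using assms unfolding trajectory_iff by blast
  have "state x (u(N := v)) k = state x u k" if "k \<le> N" for k
    using that by (intro state_cong) simp
  then have "trajectory (Suc N) (u(N := v)) (y(N := response x (u(N := v)) N))"
    unfolding trajectory_iff using x uy v
    by (intro bexI[of _ x]) (auto simp: response_def less_Suc_eq)
  then show ?thesis using that by blast
qed

lemma controllable_imp_left_kernel_trivial:
  assumes ctrb: "controllable n m A B" and \<xi>: "\<xi> \<in> carrier_vec n"
    and markov: "\<And>i v. i < n \<Longrightarrow> v \<in> carrier_vec m \<Longrightarrow> \<xi> \<bullet> (A ^\<^sub>m i *\<^sub>v (B *\<^sub>v v)) = 0"
  shows "\<xi> = 0\<^sub>v n"
proof (rule full_row_rank_imp_left_kernel_trivial)
  show M: "ctrb_mat n m A B \<in> carrier_mat n (n * m)" by (simp add: ctrb_mat_def)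
  show "vec_space.rank n (ctrb_mat n m A B) = n"
    using ctrb M by (simp add: controllable_def mrank_def)
  show "(ctrb_mat n m A B)\<^sup>T *\<^sub>v \<xi> = 0\<^sub>v (n * m)"
  proof (rule eq_vecI)
    fix c assume "c < dim_vec (0\<^sub>v (n * m) :: real vec)"
    then have c: "c < n * m" by simp
    then have m: "0 < m" by (cases m) auto
    have pow: "A ^\<^sub>m (c div m) \<in> carrier_mat n n" using A by (rule pow_carrier_mat)
    have B_unit: "B *\<^sub>v unit_vec m (c mod m) = col B (c mod m)"
      using B m by (intro eq_vecI) auto
    have "col (ctrb_mat n m A B) c = A ^\<^sub>m (c div m) *\<^sub>v (B *\<^sub>v unit_vec m (c mod m))"
      unfolding B_unit using c m B carrier_matD[OF pow] by (intro eq_vecI) (auto simp: ctrb_mat_def)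
    then have "col (ctrb_mat n m A B) c \<bullet> \<xi>
        = \<xi> \<bullet> (A ^\<^sub>m (c div m) *\<^sub>v (B *\<^sub>v unit_vec m (c mod m)))"
      using comm_scalar_prod[OF col_carrier_vec[OF c M] \<xi>] by simp
    also have "\<dots> = 0" using c by (intro markov) (simp_all add: less_mult_imp_div_less)
    finally show "((ctrb_mat n m A B)\<^sup>T *\<^sub>v \<xi>) $ c = 0\<^sub>v (n * m) $ c" using c M by simp
  qed (use M in simp)
qed (fact \<xi>)

end

section \<open>Hankel matrices\<close>

lemma block_index_less:
  fixes i j q d :: nat
  assumes "j < d" "i < q"
  shows "j * q + i < q * d"
proof -
  have "j * q + i < Suc j * q" using assms(2) by simp
  also have "\<dots> \<le> d * q" using assms(1) by (intro mult_le_mono1) simp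
  finally show ?thesis by (simp add: mult.commute)
qed

lemma block_index_cases:
  fixes r q d :: nat
  assumes "r < q * d"
  obtains i j where "j < d" "i < q" "r = j * q + i"
proof -
  have "q > 0" using assms by (cases q) auto
  moreover have "r div q < d" using assms by (simp add: less_mult_imp_div_less mult.commute)
  ultimately show ?thesis using that[of "r div q" "r mod q"] by simp
qed

lemma stack_carrier [simp]: "stack q d w \<in> carrier_vec (q * d)"
  by (simp add: stack_def)

lemma dim_stack [simp]: "dim_vec (stack q d w) = q * d"
  by (simp add: stack_def)

lemma stack_index:
  assumes "j < d" "i < q"
  shows "stack q d w $ (j * q + i) = w j $ i"
  using block_index_less[OF assms] assms by (simp add: stack_def)

lemma stack_eq_iff:
  assumes v: "v \<in> carrier_vec (q * d)"
  shows "stack q d w = v \<longleftrightarrow> (\<forall>j<d. \<forall>i<q. w j $ i = v $ (j * q + i))"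
proof
  assume blocks: "\<forall>j<d. \<forall>i<q. w j $ i = v $ (j * q + i)"
  show "stack q d w = v"
  proof (rule eq_vecI)
    fix r assume "r < dim_vec v"
    then have "r < q * d" using v by simp
    then obtain i j where "j < d" "i < q" "r = j * q + i" by (rule block_index_cases)
    then show "stack q d w $ r = v $ r" using blocks by (simp add: stack_index)
  qed (use v in simp)
qed (auto simp: stack_index)

lemma scalar_prod_stack:
  assumes "\<And>j. j < d \<Longrightarrow> v j \<in> carrier_vec q"
  shows "stack q d w \<bullet> stack q d v = (\<Sum>j<d. w j \<bullet> v j)"
proof -
  let ?f = "\<lambda>r. stack q d w $ r * stack q d v $ r"
  have "sum ?f {j * q..<j * q + q} = w j \<bullet> v j" if j: "j < d" for j
  proof -
    have "sum ?f {j * q..<j * q + q} = (\<Sum>i<q. ?f (j * q + i))"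
      using sum.shift_bounds_nat_ivl[of ?f 0 "j * q" q] by (simp add: add.commute atLeast0LessThan)
    then show ?thesis
      using assms[OF j] j by (simp add: stack_index scalar_prod_def atLeast0LessThan)
  qed
  then show ?thesis
    using sum.nat_group[of ?f q d] by (simp add: scalar_prod_def atLeast0LessThan mult.commute)
qed

lemma hankel_carrier [simp]: "hankel q d N w \<in> carrier_mat (q * d) (N - d + 1)"
  by (simp add: hankel_def)

lemma row_hankel:
  assumes "j < d" "i < q"
  shows "row (hankel q d N w) (j * q + i) = row (window_mat q (N - d + 1) w j) i"
  using block_index_less[OF assms] assms
  by (intro eq_vecI) (auto simp: hankel_def window_mat_def)

lemma col_hankel:
  assumes "c < N - d + 1"
  shows "col (hankel q d N w) c = stack q d (\<lambda>j. w (j + c))"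
  using assms by (intro eq_vecI) (simp_all add: hankel_def stack_def)

lemma stack_eq_hankel_iff:
  assumes "\<And>j. j < d \<Longrightarrow> w j \<in> carrier_vec q"
  shows "stack q d w = hankel q d N wd *\<^sub>v \<alpha> \<longleftrightarrow>
    (\<forall>j<d. w j = window_mat q (N - d + 1) wd j *\<^sub>v \<alpha>)"
proof -
  have carrier: "hankel q d N wd *\<^sub>v \<alpha> \<in> carrier_vec (q * d)"
    by (rule carrier_vecI) (simp add: hankel_def)
  have entry: "(hankel q d N wd *\<^sub>v \<alpha>) $ (j * q + i) = (window_mat q (N - d + 1) wd j *\<^sub>v \<alpha>) $ i"
    if "j < d" "i < q" for i j
    using block_index_less[OF that] that row_hankel[OF that, of N wd]
    by (simp add: carrier_matD[OF hankel_carrier] carrier_matD[OF window_mat_carrier])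
  have "w j = window_mat q (N - d + 1) wd j *\<^sub>v \<alpha> \<longleftrightarrow>
      (\<forall>i<q. w j $ i = (window_mat q (N - d + 1) wd j *\<^sub>v \<alpha>) $ i)" if "j < d" for j
    using assms[OF that] window_mat_mult_carrier[of q "N - d + 1" wd j \<alpha>]
    by (metis carrier_vecD eq_vecI)
  then show ?thesis unfolding stack_eq_iff[OF carrier] using entry by auto
qed

lemma pers_exc_obtain_combination:
  assumes pe: "pers_exc m d N ud" and u: "\<And>j. j < d \<Longrightarrow> u j \<in> carrier_vec m"
  obtains \<alpha> where "\<alpha> \<in> carrier_vec (N - d + 1)"
    "\<And>j. j < d \<Longrightarrow> u j = window_mat m (N - d + 1) ud j *\<^sub>v \<alpha>"
proof -
  have "vec_space.rank (m * d) (hankel m d N ud) = m * d"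
    using pe by (simp add: pers_exc_def mrank_def carrier_matD[OF hankel_carrier])
  then obtain \<alpha> where "\<alpha> \<in> carrier_vec (N - d + 1)" "hankel m d N ud *\<^sub>v \<alpha> = stack m d u"
    using vec_space.full_row_rank_imp_surj[OF hankel_carrier _ stack_carrier] by blast
  then show ?thesis using that stack_eq_hankel_iff[where w = u and q = m and d = d, OF u] by metis
qed

lemma pers_exc_imp_le_length:
  assumes "pers_exc m d N u" "1 < m * d"
  shows "d \<le> N"
proof -
  have "m * d \<le> N - d + 1"
    using assms(1) vec_space.rank_le_nc[OF hankel_carrier[of m d N u]]
    by (simp add: pers_exc_def mrank_def carrier_matD[OF hankel_carrier])
  then show ?thesis using assms(2) by linarith
qed

section \<open>Willems' fundamental lemma\<close>

definition window_functional ::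
  "'a :: comm_semiring_0 vec \<Rightarrow> (nat \<Rightarrow> 'a vec) \<Rightarrow> nat \<Rightarrow> 'a vec \<Rightarrow> (nat \<Rightarrow> 'a vec) \<Rightarrow> 'a" where
  "window_functional \<xi> \<eta> d x u = \<xi> \<bullet> x + (\<Sum>i<d. \<eta> i \<bullet> u i)"

lemma window_functional_window_mat:
  assumes \<alpha>: "\<alpha> \<in> carrier_vec M" and x: "\<And>c. c < M \<Longrightarrow> x (j + c) \<in> carrier_vec n"
    and u: "\<And>i c. i < d \<Longrightarrow> c < M \<Longrightarrow> u (j + i + c) \<in> carrier_vec m"
  shows "window_functional \<xi> \<eta> d (window_mat n M x j *\<^sub>v \<alpha>) (\<lambda>i. window_mat m M u (j + i) *\<^sub>v \<alpha>)
    = (\<Sum>c<M. \<alpha> $ c * window_functional \<xi> \<eta> d (x (j + c)) (\<lambda>i. u (j + i + c)))"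
proof -
  have "(\<Sum>i<d. \<eta> i \<bullet> (window_mat m M u (j + i) *\<^sub>v \<alpha>))
      = (\<Sum>i<d. \<Sum>c<M. \<alpha> $ c * (\<eta> i \<bullet> u (j + i + c)))"
    using u by (intro sum.cong refl scalar_prod_window_mat[OF \<alpha>]) auto
  also have "\<dots> = (\<Sum>c<M. \<Sum>i<d. \<alpha> $ c * (\<eta> i \<bullet> u (j + i + c)))" by (rule sum.swap)
  finally show ?thesis
    by (simp add: window_functional_def sum.distrib sum_distrib_left distrib_left
        scalar_prod_window_mat[where w = x and j = j, OF \<alpha> x])
qed

context lti_system
begin

lemma state_window_mat:
  assumes x: "x \<in> carrier_vec n" and u: "\<And>k. k < N \<Longrightarrow> u k \<in> carrier_vec m"
    and \<alpha>: "\<alpha> \<in> carrier_vec M" and "j + M \<le> Suc N"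
  shows "state (window_mat n M (state x u) 0 *\<^sub>v \<alpha>) (\<lambda>i. window_mat m M u i *\<^sub>v \<alpha>) j
    = window_mat n M (state x u) j *\<^sub>v \<alpha>"
  using assms(4)
proof (induction j)
  case (Suc j)
  have xk: "state x u k \<in> carrier_vec n" if "k \<le> N" for k
    using that u by (intro state_carrier[OF x]) simp
  have "window_mat n M (state x u) (Suc j) *\<^sub>v \<alpha>
      = A *\<^sub>v (window_mat n M (state x u) j *\<^sub>v \<alpha>) + B *\<^sub>v (window_mat m M u j *\<^sub>v \<alpha>)"
    by (rule window_mat_affine[OF A B \<alpha>]) (use Suc.prems xk u in auto)
  then show ?case using Suc by simp
qed simp

lemma response_window_mat:
  assumes x: "x \<in> carrier_vec n" and u: "\<And>k. k < N \<Longrightarrow> u k \<in> carrier_vec m"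
    and y: "\<And>k. k < N \<Longrightarrow> y k = response x u k"
    and \<alpha>: "\<alpha> \<in> carrier_vec M" and jM: "j + M \<le> N"
  shows "response (window_mat n M (state x u) 0 *\<^sub>v \<alpha>) (\<lambda>i. window_mat m M u i *\<^sub>v \<alpha>) j
    = window_mat p M y j *\<^sub>v \<alpha>"
proof -
  have "window_mat p M y j *\<^sub>v \<alpha> =
      C *\<^sub>v (window_mat n M (state x u) j *\<^sub>v \<alpha>) + D *\<^sub>v (window_mat m M u j *\<^sub>v \<alpha>)"
    using jM by (intro window_mat_affine[OF C D \<alpha>])
      (auto simp: y response_def intro!: state_carrier x u)
  moreover have "state (window_mat n M (state x u) 0 *\<^sub>v \<alpha>) (\<lambda>i. window_mat m M u i *\<^sub>v \<alpha>) j
      = window_mat n M (state x u) j *\<^sub>v \<alpha>"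
    by (rule state_window_mat[where N = N]) (use x u \<alpha> jM in auto)
  ultimately show ?thesis by (simp add: response_def)
qed

context
  fixes d N :: nat and ud :: "nat \<Rightarrow> real vec" and xd \<xi> :: "real vec" and \<eta> :: "nat \<Rightarrow> real vec"
  assumes pe: "pers_exc m (d + n) N ud" and dN: "d + n \<le> N"
    and xd: "xd \<in> carrier_vec n" and ud: "\<And>k. k < N \<Longrightarrow> ud k \<in> carrier_vec m"
    and \<xi>: "\<xi> \<in> carrier_vec n" and \<eta>: "\<And>i. i < d \<Longrightarrow> \<eta> i \<in> carrier_vec m"
    and annihilates: "\<And>k. k < N - d + 1 \<Longrightarrow>
      window_functional \<xi> \<eta> d (state xd ud k) (\<lambda>i. ud (k + i)) = 0"
begin

text \<open>By persistency of excitation, every trajectory of length \<open>d + n\<close> is a combination of data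
  windows plus a free response, and the recurrence annihilates the free response.\<close>
lemma annihilator_recurrence:
  assumes a: "\<And>v. v \<in> carrier_vec n \<Longrightarrow> (\<Sum>j\<le>n. a j * (\<xi> \<bullet> (A ^\<^sub>m j *\<^sub>v v))) = 0"
    and x: "x \<in> carrier_vec n" and u: "\<And>k. u k \<in> carrier_vec m"
  shows "(\<Sum>j\<le>n. a j * window_functional \<xi> \<eta> d (state x u j) (\<lambda>i. u (j + i))) = 0"
proof -
  define M where "M = N - (d + n) + 1"
  obtain \<alpha> where \<alpha>: "\<alpha> \<in> carrier_vec M"
    and u_eq: "\<And>j. j < d + n \<Longrightarrow> u j = window_mat m M ud j *\<^sub>v \<alpha>"
    using pers_exc_obtain_combination[OF pe, of u] u unfolding M_def by blast
  define z where "z = window_mat n M (state xd ud) 0 *\<^sub>v \<alpha>"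
  have z: "z \<in> carrier_vec n" by (simp add: z_def)
  have "window_functional \<xi> \<eta> d (state x u j) (\<lambda>i. u (j + i)) = \<xi> \<bullet> (A ^\<^sub>m j *\<^sub>v (x - z))"
    if j: "j \<le> n" for j
  proof -
    have "state z u j = state z (\<lambda>i. window_mat m M ud i *\<^sub>v \<alpha>) j"
      using u_eq j by (intro state_cong) simp
    also have "\<dots> = window_mat n M (state xd ud) j *\<^sub>v \<alpha>"
      unfolding z_def using dN j by (intro state_window_mat[OF xd ud \<alpha>]) (auto simp: M_def)
    finally have "window_functional \<xi> \<eta> d (state z u j) (\<lambda>i. u (j + i)) =
        window_functional \<xi> \<eta> d (window_mat n M (state xd ud) j *\<^sub>v \<alpha>)
          (\<lambda>i. window_mat m M ud (j + i) *\<^sub>v \<alpha>)"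
      using u_eq j by (simp add: window_functional_def)
    also have "\<dots> =
        (\<Sum>c<M. \<alpha> $ c * window_functional \<xi> \<eta> d (state xd ud (j + c)) (\<lambda>i. ud (j + i + c)))"
      using dN j by (intro window_functional_window_mat[OF \<alpha>] state_carrier[OF xd] ud)
        (auto simp: M_def)
    also have "\<dots> = 0"
      using annihilates[of "j + _"] dN j by (intro sum.neutral) (auto simp: M_def add_ac)
    finally have "window_functional \<xi> \<eta> d (state z u j) (\<lambda>i. u (j + i)) = 0" .
    then show ?thesis
      using \<xi> x z u state_eq_plus_free_response[OF x z, of j u]
      by (simp add: window_functional_def scalar_prod_add_distrib[of _ n] state_carrier
          mult_mat_vec_carrier[OF pow_carrier_mat[OF A]])
  qed
  then show ?thesis using a[of "x - z"] x z by simp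
qed

lemma annihilator_vanishes_after_rest:
  assumes u: "\<And>k. u k \<in> carrier_vec m" and rest: "\<And>k. k < n + d \<Longrightarrow> u k = 0\<^sub>v m"
  shows "window_functional \<xi> \<eta> d (state (0\<^sub>v n) u k) (\<lambda>i. u (k + i)) = 0"
proof -
  obtain a where a: "a n = 1" "\<And>v. v \<in> carrier_vec n \<Longrightarrow> (\<Sum>j\<le>n. a j * (\<xi> \<bullet> (A ^\<^sub>m j *\<^sub>v v))) = 0"
    using pow_mat_monic_annihilator[OF A \<xi>] by blast
  define s where "s k = window_functional \<xi> \<eta> d (state (0\<^sub>v n) u k) (\<lambda>i. u (k + i))" for k
  have "s k = 0"
  proof (rule linear_recurrence_eq_0[where a = a and n = n and s = s])
    show "(\<Sum>j\<le>n. a j * s (k + j)) = 0" for k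
      using annihilator_recurrence[OF a(2), of "state (0\<^sub>v n) u k" "\<lambda>i. u (k + i)"] u
      by (simp add: s_def state_carrier state_add add.assoc)
    show "s k = 0" if "k < n" for k
      using that \<xi> \<eta> rest state_zero[of k u] by (simp add: s_def window_functional_def)
  qed (fact a(1))
  then show ?thesis by (simp add: s_def)
qed

lemma annihilator_trivial:
  assumes ctrb: "controllable n m A B"
  shows "\<xi> = 0\<^sub>v n" and "\<And>i. i < d \<Longrightarrow> \<eta> i = 0\<^sub>v m"
proof -
  define impulse where "impulse s v = (\<lambda>k. if k = s then v else 0\<^sub>v m)"
    for s :: nat and v :: "real vec"
  have vanishes:
      "window_functional \<xi> \<eta> d (state (0\<^sub>v n) (impulse s v) k) (\<lambda>i. impulse s v (k + i)) = 0"
    if "n + d \<le> s" "v \<in> carrier_vec m" for s v k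
    by (rule annihilator_vanishes_after_rest) (use that in \<open>auto simp: impulse_def\<close>)
  show "\<eta> i = 0\<^sub>v m" if i: "i < d" for i
  proof -
    let ?u = "impulse (n + d + i) (\<eta> i)"
    have "state (0\<^sub>v n) ?u (n + d) = 0\<^sub>v n" by (rule state_zero) (simp add: impulse_def)
    then have "(\<Sum>q<d. \<eta> q \<bullet> ?u (n + d + q)) = 0"
      using vanishes[of "n + d + i" "\<eta> i" "n + d"] \<eta>[OF i] \<xi> by (simp add: window_functional_def)
    moreover have "(\<Sum>q<d. \<eta> q \<bullet> ?u (n + d + q)) = (\<Sum>q<d. if q = i then \<eta> i \<bullet> \<eta> i else 0)"
      using \<eta> by (intro sum.cong) (auto simp: impulse_def)
    ultimately have "\<eta> i \<bullet> \<eta> i = 0" using i by simp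
    then show ?thesis using conjugate_square_eq_0_vec[OF \<eta>[OF i]] by simp
  qed
  show "\<xi> = 0\<^sub>v n"
  proof (rule controllable_imp_left_kernel_trivial[OF ctrb \<xi>])
    fix i and v :: "real vec" assume v: "v \<in> carrier_vec m"
    have "(\<Sum>q<d. \<eta> q \<bullet> impulse (n + d) v (Suc (n + d) + i + q)) = 0"
      using \<eta> by (intro sum.neutral) (simp add: impulse_def)
    moreover have "state (0\<^sub>v n) (impulse (n + d) v) (Suc (n + d) + i) = A ^\<^sub>m i *\<^sub>v (B *\<^sub>v v)"
      unfolding impulse_def by (rule state_impulse[OF v])
    ultimately show "\<xi> \<bullet> (A ^\<^sub>m i *\<^sub>v (B *\<^sub>v v)) = 0"
      using vanishes[OF order_refl v, of "Suc (n + d) + i"] by (simp add: window_functional_def)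
  qed
qed

end

definition state_input_mat :: "nat \<Rightarrow> nat \<Rightarrow> real vec \<Rightarrow> (nat \<Rightarrow> real vec) \<Rightarrow> real mat" where
  "state_input_mat d N x u = window_mat n (N - d + 1) (state x u) 0 @\<^sub>r hankel m d N u"

lemma state_input_mat_carrier: "state_input_mat d N x u \<in> carrier_mat (n + m * d) (N - d + 1)"
  unfolding state_input_mat_def by (rule carrier_append_rows[OF window_mat_carrier hankel_carrier])

lemma col_state_input_mat:
  assumes k: "k < N - d + 1" and x: "state x u k \<in> carrier_vec n"
  shows "col (state_input_mat d N x u) k = state x u k @\<^sub>v stack m d (\<lambda>i. u (k + i))"
proof -
  have "col (state_input_mat d N x u) k =
      col (window_mat n (N - d + 1) (state x u) 0) k @\<^sub>v col (hankel m d N u) k"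
    using k by (intro eq_vecI) (auto simp: state_input_mat_def append_rows_def
        carrier_matD[OF window_mat_carrier] carrier_matD[OF hankel_carrier])
  moreover have "col (window_mat n (N - d + 1) (state x u) 0) k = state x u k"
    using x k by (intro eq_vecI) (auto simp: window_mat_def)
  ultimately show ?thesis using col_hankel[OF k] by (simp add: add.commute)
qed

lemma state_input_mat_left_kernel_trivial:
  assumes ctrb: "controllable n m A B" and pe: "pers_exc m (d + n) N ud" and dN: "d + n \<le> N"
    and xd: "xd \<in> carrier_vec n" and ud: "\<And>k. k < N \<Longrightarrow> ud k \<in> carrier_vec m"
    and v: "v \<in> carrier_vec (n + m * d)"
    and kernel: "(state_input_mat d N xd ud)\<^sup>T *\<^sub>v v = 0\<^sub>v (N - d + 1)"
  shows "v = 0\<^sub>v (n + m * d)"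
proof -
  note carrier = state_input_mat_carrier[of d N xd ud]
  define \<xi> where "\<xi> = vec_first v n"
  define h where "h = vec_last v (m * d)"
  define \<eta> where "\<eta> j = vec m (\<lambda>i. h $ (j * m + i))" for j
  have \<xi>: "\<xi> \<in> carrier_vec n" and h: "h \<in> carrier_vec (m * d)" and \<eta>: "\<eta> j \<in> carrier_vec m" for j
    by (simp_all add: \<xi>_def h_def \<eta>_def)
  have v_eq: "v = \<xi> @\<^sub>v h" using v by (simp add: \<xi>_def h_def)
  have h_eq: "h = stack m d \<eta>" using stack_eq_iff[OF h, of \<eta>] by (simp add: \<eta>_def)
  have "window_functional \<xi> \<eta> d (state xd ud k) (\<lambda>i. ud (k + i)) = 0" if k: "k < N - d + 1" for k
  proof -
    have xk: "state xd ud k \<in> carrier_vec n" using xd ud k dN by (intro state_carrier) auto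
    have "0 = v \<bullet> col (state_input_mat d N xd ud) k"
      using arg_cong[OF kernel, of "\<lambda>w. w $ k"] k carrier
        comm_scalar_prod[OF v col_carrier_vec[OF k carrier]]
      by simp
    also have "\<dots> = \<xi> \<bullet> state xd ud k + stack m d \<eta> \<bullet> stack m d (\<lambda>i. ud (k + i))"
      using scalar_prod_append[OF \<xi> h xk stack_carrier] v_eq h_eq
        col_state_input_mat[OF k xk] by simp
    also have "\<dots> = window_functional \<xi> \<eta> d (state xd ud k) (\<lambda>i. ud (k + i))"
      using ud k dN by (subst scalar_prod_stack) (auto simp: window_functional_def)
    finally show ?thesis by simp
  qed
  note trivial = annihilator_trivial[OF pe dN xd ud \<xi> \<eta> this ctrb]
  have "h = 0\<^sub>v (m * d)"
    unfolding h_eq by (subst stack_eq_iff) (auto simp: trivial(2) block_index_less)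
  then show ?thesis using v_eq trivial(1) by auto
qed

lemma obtain_data_combination:
  assumes ctrb: "controllable n m A B" and pe: "pers_exc m (d + n) N ud" and dN: "d + n \<le> N"
    and xd: "xd \<in> carrier_vec n" and ud: "\<And>k. k < N \<Longrightarrow> ud k \<in> carrier_vec m"
    and x: "x \<in> carrier_vec n" and u: "\<And>j. j < d \<Longrightarrow> u j \<in> carrier_vec m"
  obtains \<alpha> where "\<alpha> \<in> carrier_vec (N - d + 1)"
    "x = window_mat n (N - d + 1) (state xd ud) 0 *\<^sub>v \<alpha>"
    "\<And>j. j < d \<Longrightarrow> u j = window_mat m (N - d + 1) ud j *\<^sub>v \<alpha>"
proof -
  let ?X = "window_mat n (N - d + 1) (state xd ud) 0" and ?H = "hankel m d N ud"
  obtain \<alpha> where \<alpha>: "\<alpha> \<in> carrier_vec (N - d + 1)"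
    and "state_input_mat d N xd ud *\<^sub>v \<alpha> = x @\<^sub>v stack m d u"
    using left_kernel_trivial_imp_surj[OF state_input_mat_carrier
        state_input_mat_left_kernel_trivial[OF ctrb pe dN xd ud]
        append_carrier_vec[OF x stack_carrier]]
    by blast
  then have "(?X *\<^sub>v \<alpha>) @\<^sub>v (?H *\<^sub>v \<alpha>) = x @\<^sub>v stack m d u"
    using mat_mult_append[OF window_mat_carrier hankel_carrier \<alpha>] by (simp add: state_input_mat_def)
  then have "?X *\<^sub>v \<alpha> = x" "stack m d u = ?H *\<^sub>v \<alpha>"
    using append_vec_eq[OF _ x, of "?X *\<^sub>v \<alpha>"] by auto
  then show ?thesis
    using that \<alpha> stack_eq_hankel_iff[of d u m N ud \<alpha>] u by metis
qed

lemma trajectory_iff_data_combination: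
  assumes ctrb: "controllable n m A B" and pe: "pers_exc m (d + n) N ud" and dN: "d + n \<le> N"
    and data: "trajectory N ud yd" and u: "\<And>j. j < d \<Longrightarrow> u j \<in> carrier_vec m"
  shows "trajectory d u y \<longleftrightarrow> (\<exists>\<alpha>\<in>carrier_vec (N - d + 1).
    (\<forall>j<d. u j = window_mat m (N - d + 1) ud j *\<^sub>v \<alpha>) \<and>
    (\<forall>j<d. y j = window_mat p (N - d + 1) yd j *\<^sub>v \<alpha>))" (is "_ \<longleftrightarrow> ?combination")
proof -
  let ?M = "N - d + 1"
  obtain xd where xd: "xd \<in> carrier_vec n" and ud: "\<And>k. k < N \<Longrightarrow> ud k \<in> carrier_vec m"
    and yd: "\<And>k. k < N \<Longrightarrow> yd k = response xd ud k"
    using data unfolding trajectory_iff by blast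
  let ?x = "\<lambda>\<alpha>. window_mat n ?M (state xd ud) 0 *\<^sub>v \<alpha>"
  have y_eq_iff: "y j = response (?x \<alpha>) u j \<longleftrightarrow> y j = window_mat p ?M yd j *\<^sub>v \<alpha>"
    if \<alpha>: "\<alpha> \<in> carrier_vec ?M" and u_eq: "\<And>j. j < d \<Longrightarrow> u j = window_mat m ?M ud j *\<^sub>v \<alpha>"
      and j: "j < d" for \<alpha> j
    using response_window_mat[where u = ud and y = yd and N = N and j = j, OF xd ud yd \<alpha>]
      state_cong[of j u "\<lambda>i. window_mat m ?M ud i *\<^sub>v \<alpha>"] u_eq j dN
    by (simp add: response_def)
  show ?thesis
  proof
    assume "trajectory d u y"
    then obtain x where x: "x \<in> carrier_vec n" "\<And>j. j < d \<Longrightarrow> y j = response x u j"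
      unfolding trajectory_iff by blast
    obtain \<alpha> where \<alpha>: "\<alpha> \<in> carrier_vec ?M" "x = ?x \<alpha>"
      "\<And>j. j < d \<Longrightarrow> u j = window_mat m ?M ud j *\<^sub>v \<alpha>"
      using obtain_data_combination[where u = u, OF ctrb pe dN xd ud x(1) u] by blast
    then have "y j = window_mat p ?M yd j *\<^sub>v \<alpha>" if "j < d" for j
      using y_eq_iff[OF \<alpha>(1,3) that] x(2)[OF that] by simp
    with \<alpha>(1,3) show ?combination by blast
  next
    assume ?combination
    then obtain \<alpha> where \<alpha>: "\<alpha> \<in> carrier_vec ?M"
      "\<And>j. j < d \<Longrightarrow> u j = window_mat m ?M ud j *\<^sub>v \<alpha>"
      "\<And>j. j < d \<Longrightarrow> y j = window_mat p ?M yd j *\<^sub>v \<alpha>"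
      by blast
    then show "trajectory d u y"
      unfolding trajectory_iff using u y_eq_iff[OF \<alpha>(1,2)] window_mat_mult_carrier
      by (intro bexI[of _ "?x \<alpha>"]) blast+
  qed
qed

theorem willems_fundamental_lemma:
  assumes "controllable n m A B" "pers_exc m (d + n) N ud" "d + n \<le> N" "trajectory N ud yd"
    and u: "\<And>j. j < d \<Longrightarrow> u j \<in> carrier_vec m" and y: "\<And>j. j < d \<Longrightarrow> y j \<in> carrier_vec p"
  shows "trajectory d u y \<longleftrightarrow> (\<exists>\<alpha>\<in>carrier_vec (N - d + 1).
    stack m d u = hankel m d N ud *\<^sub>v \<alpha> \<and> stack p d y = hankel p d N yd *\<^sub>v \<alpha>)"
  using trajectory_iff_data_combination[where u = u, OF assms(1-4) u]
  by (simp only: stack_eq_hankel_iff[where w = u, OF u] stack_eq_hankel_iff[where w = y, OF y])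

end

section \<open>Equilibria\<close>

lemma lag_rank:
  assumes "observable n p A C" "0 < n"
  shows "mrank (obsv_mat n p (lag n p A C) A C) = n"
  unfolding lag_def
  using LeastI[of "\<lambda>l. 1 \<le> l \<and> l \<le> n \<and> mrank (obsv_mat n p l A C) = n" n] assms
  by (simp add: observable_def)

context lti_system
begin

lemma observable_imp_eq_0:
  assumes obsv: "observable n p A C" and x: "x \<in> carrier_vec n"
    and unobserved: "\<And>k. k < lag n p A C \<Longrightarrow> C *\<^sub>v (A ^\<^sub>m k *\<^sub>v x) = 0\<^sub>v p"
  shows "x = 0\<^sub>v n"
proof (cases "n = 0")
  case False
  let ?l = "lag n p A C" and ?O = "obsv_mat n p (lag n p A C) A C"
  have O: "?O \<in> carrier_mat (p * ?l) n" by (simp add: obsv_mat_def)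
  have "?O *\<^sub>v x = 0\<^sub>v (p * ?l)"
  proof (rule eq_vecI)
    fix r assume "r < dim_vec (0\<^sub>v (p * ?l) :: real vec)"
    then have r: "r < p * ?l" by simp
    then obtain i j where ij: "j < ?l" "i < p" "r = j * p + i" by (rule block_index_cases)
    have pow: "A ^\<^sub>m j \<in> carrier_mat n n" using A by (rule pow_carrier_mat)
    have "row ?O r = row (C * A ^\<^sub>m j) i"
      using r ij carrier_matD[OF mult_carrier_mat[OF C pow]]
      by (intro eq_vecI) (simp_all add: obsv_mat_def del: index_mult_mat)
    then have "(?O *\<^sub>v x) $ r = ((C * A ^\<^sub>m j) *\<^sub>v x) $ i" using r ij C O by simp
    also have "\<dots> = 0" using assoc_mult_mat_vec[OF C pow x] unobserved[OF ij(1)] ij(2) by simp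
    finally show "(?O *\<^sub>v x) $ r = 0\<^sub>v (p * ?l) $ r" using r by simp
  qed (use O in simp)
  then show ?thesis
    using vec_space.full_col_rank_imp_inj[OF O _ x] lag_rank[OF obsv] False O
    by (simp add: mrank_def)
qed (use x in auto)

lemma equilibrium_trajectory:
  assumes obsv: "observable n p A C" and eq: "equilibrium n m p A B C D us ys"
  shows "trajectory N (\<lambda>_. us) (\<lambda>_. ys)"
proof -
  let ?l = "lag n p A C" and ?us = "\<lambda>_ :: nat. us"
  have us: "us \<in> carrier_vec m" using eq by (simp add: equilibrium_def)
  obtain x where x: "x \<in> carrier_vec n" and ys: "\<And>k. k \<le> ?l \<Longrightarrow> ys = response x ?us k"
    using eq unfolding equilibrium_def trajectory_iff by (auto simp: less_Suc_eq_le)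
  have xk: "state x ?us k \<in> carrier_vec n" for k using x us by (simp add: state_carrier)
  have "state x ?us 1 - x = 0\<^sub>v n"
  proof (rule observable_imp_eq_0[OF obsv])
    fix k assume k: "k < ?l"
    have "A ^\<^sub>m k *\<^sub>v (state x ?us 1 - x) = state (state x ?us 1 - x) (\<lambda>_. us - us) k"
      using xk x us by (simp add: state_zero_input minus_cancel_vec[OF us] del: state.simps)
    also have "\<dots> = state x ?us (Suc k) - state x ?us k"
      using state_minus[where u = ?us and u' = ?us and k = k, OF xk[of 1] x] us
        state_add[of x ?us 1 k]
      by simp
    finally have "C *\<^sub>v (A ^\<^sub>m k *\<^sub>v (state x ?us 1 - x))
        = C *\<^sub>v state x ?us (Suc k) - C *\<^sub>v state x ?us k"
      using mult_minus_distrib_mat_vec[OF C xk xk] by (simp del: state.simps)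
    also have "\<dots> = response x ?us (Suc k) - response x ?us k"
      using C D us xk[of k] xk[of "Suc k"]
      by (intro eq_vecI) (simp_all add: response_def del: state.simps)
    also have "\<dots> = 0\<^sub>v p"
      using ys[of k] ys[of "Suc k"] k response_carrier[of x k ?us] x us by simp
    finally show "C *\<^sub>v (A ^\<^sub>m k *\<^sub>v (state x ?us 1 - x)) = 0\<^sub>v p" .
  qed (use xk[of 1] x in simp)
  then have "state x ?us 1 = x" using vec_minus_eq_0_iff[OF xk[of 1] x] by blast
  then have "state x ?us k = x" for k by (induction k) simp_all
  then have "ys = response x ?us k" for k using ys[of 0] by (simp add: response_def)
  then show ?thesis unfolding trajectory_iff using x us by (intro bexI[of _ x]) auto
qed

end

section \<open>Extended states\<close>

lemma ext_state_carrier [simp]: "ext_state m p l u y t \<in> carrier_vec ((m + p) * l)"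
  unfolding ext_state_def add_mult_distrib by (intro append_carrier_vec stack_carrier)

lemma dim_ext_state [simp]: "dim_vec (ext_state m p l u y t) = (m + p) * l"
  using ext_state_carrier by (rule carrier_vecD)

lemma ext_state_index_input:
  assumes "j < l" "i < m"
  shows "ext_state m p l u y t $ (j * m + i) = u (t + j) $ i"
  using block_index_less[OF assms] stack_index[OF assms, of "\<lambda>j. u (t + j)"]
  by (simp add: ext_state_def)

lemma ext_state_index_output:
  assumes "j < l" "i < p"
  shows "ext_state m p l u y t $ (m * l + (j * p + i)) = y (t + j) $ i"
  using block_index_less[OF assms] stack_index[OF assms, of "\<lambda>j. y (t + j)"]
  by (simp add: ext_state_def)

lemma ext_index_less:
  fixes m p l i j :: nat
  shows "j < l \<Longrightarrow> i < m \<Longrightarrow> j * m + i < (m + p) * l"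
    and "j < l \<Longrightarrow> i < p \<Longrightarrow> m * l + (j * p + i) < (m + p) * l"
  using block_index_less[of j l i m] block_index_less[of j l i p] by (auto simp: add_mult_distrib)

lemma ext_vec_eqI:
  assumes v: "v \<in> carrier_vec ((m + p) * l)" and w: "w \<in> carrier_vec ((m + p) * l)"
    and inputs: "\<And>j i. j < l \<Longrightarrow> i < m \<Longrightarrow> v $ (j * m + i) = w $ (j * m + i)"
    and outputs: "\<And>j i. j < l \<Longrightarrow> i < p \<Longrightarrow> v $ (m * l + (j * p + i)) = w $ (m * l + (j * p + i))"
  shows "v = w"
proof (rule eq_vecI)
  fix r assume "r < dim_vec w"
  then have r: "r < m * l + p * l" using w by (simp add: add_mult_distrib)
  show "v $ r = w $ r"
  proof (cases "r < m * l")
    case True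
    then obtain i j where "j < l" "i < m" "r = j * m + i" by (rule block_index_cases)
    then show ?thesis using inputs by simp
  next
    case False
    then have "r - m * l < p * l" using r by linarith
    then obtain i j where ij: "j < l" "i < p" "r - m * l = j * p + i" by (rule block_index_cases)
    have "r = m * l + (j * p + i)" using ij(3) False by linarith
    then show ?thesis using outputs ij by simp
  qed
qed (use v w in simp)

lemma ext_state_cong:
  assumes "\<And>j. j < l \<Longrightarrow> u (s + j) = u' (t + j)" "\<And>j. j < l \<Longrightarrow> y (s + j) = y' (t + j)"
  shows "ext_state m p l u y s = ext_state m p l u' y' t"
  by (rule ext_vec_eqI[of _ m p l]) (auto simp: ext_state_index_input ext_state_index_output assms)

lemma ext_state_minus:
  assumes "us \<in> carrier_vec m" "ys \<in> carrier_vec p"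
  shows "ext_state m p l u y t - ext_state m p l (\<lambda>_. us) (\<lambda>_. ys) s
    = ext_state m p l (\<lambda>k. u k - us) (\<lambda>k. y k - ys) t"
  by (rule ext_vec_eqI[of _ m p l])
    (use assms in \<open>auto simp: ext_state_index_input ext_state_index_output ext_index_less\<close>)

lemma vnorm_ext_state:
  assumes u: "\<And>j. j < l \<Longrightarrow> u (t + j) \<in> carrier_vec m" and y: "\<And>j. j < l \<Longrightarrow> y (t + j) \<in> carrier_vec p"
  shows "vnorm (ext_state m p l u y t) = sqrt (\<Sum>j<l. u (t + j) \<bullet> u (t + j) + y (t + j) \<bullet> y (t + j))"
  unfolding vnorm_def ext_state_def
  using u y by (simp add: scalar_prod_stack sum.distrib
      scalar_prod_append[OF stack_carrier stack_carrier stack_carrier stack_carrier])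

lemma At_carrier [simp]: "At m p l G F \<in> carrier_mat ((m + p) * l) ((m + p) * l)"
  by (simp add: At_def)

lemma Bt_carrier [simp]: "Bt m p l D \<in> carrier_mat ((m + p) * l) m"
  by (simp add: Bt_def)

lemma Ct_carrier [simp]: "Ct m p l G F \<in> carrier_mat p ((m + p) * l)"
  by (simp add: Ct_def)

lemma At_mult_vec_input:
  assumes \<xi>: "\<xi> \<in> carrier_vec ((m + p) * l)" and ji: "j < l" "i < m"
  shows "(At m p l G F *\<^sub>v \<xi>) $ (j * m + i) = (if Suc j < l then \<xi> $ (Suc j * m + i) else 0)"
proof -
  have "row (At m p l G F) (j * m + i) =
      (if Suc j < l then unit_vec ((m + p) * l) (Suc j * m + i) else 0\<^sub>v ((m + p) * l))"
    using ji block_index_less[OF ji] ext_index_less(1)[OF ji, of p]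
    by (intro eq_vecI) (auto simp: At_def unit_vec_def)
  then show ?thesis
    using \<xi> ext_index_less(1)[OF ji, of p] ext_index_less(1)[of "Suc j" l i m p] ji
    by (simp add: carrier_matD[OF At_carrier] del: mult_Suc)
qed

lemma At_mult_vec_output:
  assumes \<xi>: "\<xi> \<in> carrier_vec ((m + p) * l)" and ji: "j < l" "i < p"
  shows "(At m p l G F *\<^sub>v \<xi>) $ (m * l + (j * p + i)) =
    (if Suc j < l then \<xi> $ (m * l + (Suc j * p + i)) else (Ct m p l G F *\<^sub>v \<xi>) $ i)"
proof -
  have "row (At m p l G F) (m * l + (j * p + i)) =
      (if Suc j < l then unit_vec ((m + p) * l) (m * l + (Suc j * p + i))
       else row (Ct m p l G F) i)"
    using ji ext_index_less(2)[OF ji, of m]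
    by (intro eq_vecI) (auto simp: At_def Ct_def unit_vec_def)
  then show ?thesis
    using \<xi> ext_index_less(2)[OF ji, of m] ext_index_less(2)[of "Suc j" l i p m] ji
    by (simp add: carrier_matD[OF At_carrier] carrier_matD[OF Ct_carrier] del: mult_Suc)
qed

lemma Bt_mult_vec_input:
  assumes v: "v \<in> carrier_vec m" and ji: "j < l" "i < m"
  shows "(Bt m p l D *\<^sub>v v) $ (j * m + i) = (if Suc j = l then v $ i else 0)"
proof -
  have "row (Bt m p l D) (j * m + i) = (if Suc j = l then unit_vec m i else 0\<^sub>v m)"
    using ji block_index_less[OF ji] ext_index_less(1)[OF ji, of p]
    by (intro eq_vecI) (auto simp: Bt_def unit_vec_def)
  then show ?thesis
    using v ext_index_less(1)[OF ji, of p] ji by (simp add: carrier_matD[OF Bt_carrier])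
qed

lemma Bt_mult_vec_output:
  assumes D: "D \<in> carrier_mat p m" and v: "v \<in> carrier_vec m" and ji: "j < l" "i < p"
  shows "(Bt m p l D *\<^sub>v v) $ (m * l + (j * p + i)) = (if Suc j = l then (D *\<^sub>v v) $ i else 0)"
proof -
  have "row (Bt m p l D) (m * l + (j * p + i)) = (if Suc j = l then row D i else 0\<^sub>v m)"
    using D ji ext_index_less(2)[OF ji, of m] by (intro eq_vecI) (auto simp: Bt_def)
  then show ?thesis
    using D v ext_index_less(2)[OF ji, of m] ji by (simp add: carrier_matD[OF Bt_carrier])
qed

lemma ext_state_Suc:
  assumes D: "D \<in> carrier_mat p m" and u: "u (t + l) \<in> carrier_vec m"
    and y: "y (t + l) = Ct m p l G F *\<^sub>v ext_state m p l u y t + D *\<^sub>v u (t + l)"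
  shows "ext_state m p l u y (Suc t)
    = At m p l G F *\<^sub>v ext_state m p l u y t + Bt m p l D *\<^sub>v u (t + l)" (is "_ = ?next")
proof (rule ext_vec_eqI[of _ m p l])
  show "?next \<in> carrier_vec ((m + p) * l)"
    by (rule carrier_vecI) (simp add: carrier_matD[OF Bt_carrier])
  fix j i assume j: "j < l"
  then have shift_or_last: "Suc j < l \<or> Suc j = l" by linarith
  show "ext_state m p l u y (Suc t) $ (j * m + i) = ?next $ (j * m + i)" if i: "i < m"
    using shift_or_last
    by (elim disjE) (use i j u ext_index_less(1)[OF j i, of p] in
      \<open>auto simp: At_mult_vec_input Bt_mult_vec_input ext_state_index_input
        carrier_matD[OF Bt_carrier] simp del: mult_Suc index_mult_mat_vec\<close>)
  show "ext_state m p l u y (Suc t) $ (m * l + (j * p + i)) = ?next $ (m * l + (j * p + i))"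
    if i: "i < p"
    using shift_or_last
    by (elim disjE) (use i j u y D ext_index_less(2)[OF j i, of m] in
      \<open>auto simp: At_mult_vec_output Bt_mult_vec_output[OF D] ext_state_index_output
        carrier_matD[OF Bt_carrier] simp del: mult_Suc index_mult_mat_vec\<close>)
qed simp

section \<open>Quadratic forms\<close>

lemma qf_nonneg:
  assumes "pos_def d M" "x \<in> carrier_vec d"
  shows "0 \<le> qf M x"
  using assms by (cases "x = 0\<^sub>v d") (auto simp: pos_def_def qf_def intro: less_imp_le)

lemma qf_eq_0_iff:
  assumes "pos_def d M" "x \<in> carrier_vec d"
  shows "qf M x = 0 \<longleftrightarrow> x = 0\<^sub>v d"
proof
  show "x = 0\<^sub>v d" if "qf M x = 0"
    using assms that unfolding pos_def_def qf_def by force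
  show "qf M x = 0" if "x = 0\<^sub>v d"
    using assms that mult_mat_zero_vec[of M d d] by (simp add: pos_def_def qf_def)
qed

lemma pos_def_Cauchy_Schwarz:
  assumes M: "pos_def d M" and x: "x \<in> carrier_vec d" and z: "z \<in> carrier_vec d"
  shows "(x \<bullet> (M *\<^sub>v z))\<^sup>2 \<le> qf M x * qf M z"
proof (cases "z = 0\<^sub>v d")
  case True
  have "M *\<^sub>v z = 0\<^sub>v d"
    using M True by (auto simp: pos_def_def)
  then have "x \<bullet> (M *\<^sub>v z) = 0" using x by simp
  then show ?thesis using True M x z qf_nonneg[OF M] by (auto intro: mult_nonneg_nonneg)
next
  case False
  have Mc: "M \<in> carrier_mat d d" and sym: "M\<^sup>T = M" using M by (auto simp: pos_def_def)
  have qz: "qf M z > 0" using M z False by (auto simp: pos_def_def qf_def)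
  define t where "t = x \<bullet> (M *\<^sub>v z) / qf M z"
  have carrier: "M *\<^sub>v x \<in> carrier_vec d" "M *\<^sub>v z \<in> carrier_vec d" using Mc x z by auto
  have swap: "z \<bullet> (M *\<^sub>v x) = x \<bullet> (M *\<^sub>v z)"
    using transpose_vec_mult_scalar[OF Mc x z] sym carrier(2) x by (metis comm_scalar_prod)
  have diff: "M *\<^sub>v (x - t \<cdot>\<^sub>v z) = M *\<^sub>v x - t \<cdot>\<^sub>v (M *\<^sub>v z)"
    using Mc x z by (simp add: mult_minus_distrib_mat_vec mult_mat_vec)
  have "0 \<le> qf M (x - t \<cdot>\<^sub>v z)" using qf_nonneg[OF M] x z by simp
  also have "\<dots> = (x - t \<cdot>\<^sub>v z) \<bullet> (M *\<^sub>v x - t \<cdot>\<^sub>v (M *\<^sub>v z))"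
    by (simp add: qf_def diff)
  also have "\<dots> = qf M x - 2 * t * (x \<bullet> (M *\<^sub>v z)) + t\<^sup>2 * qf M z"
    using x z carrier swap
    by (simp add: minus_scalar_prod_distrib[of _ d] scalar_prod_minus_distrib[of _ d] qf_def
        algebra_simps power2_eq_square)
  also have "\<dots> = qf M x - (x \<bullet> (M *\<^sub>v z))\<^sup>2 / qf M z"
    using qz by (simp add: t_def field_simps power2_eq_square)
  finally show ?thesis using qz by (simp add: field_simps)
qed

lemma pos_def_lower_bound:
  assumes M: "pos_def d M"
  obtains c where "c > 0" "\<And>x. x \<in> carrier_vec d \<Longrightarrow> c * (x \<bullet> x) \<le> qf M x"
proof -
  have carrier: "M \<in> carrier_mat d d" and sym: "M\<^sup>T = M" using M by (auto simp: pos_def_def)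
  have "v = 0\<^sub>v d" if "v \<in> carrier_vec d" "M\<^sup>T *\<^sub>v v = 0\<^sub>v d" for v
    using qf_eq_0_iff[OF M that(1)] that by (simp add: sym qf_def)
  then have "\<exists>w. w \<in> carrier_vec d \<and> M *\<^sub>v w = unit_vec d i" for i
    using left_kernel_trivial_imp_surj[OF carrier _ unit_vec_carrier] by blast
  then obtain w where w: "\<And>i. w i \<in> carrier_vec d" "\<And>i. M *\<^sub>v w i = unit_vec d i" by metis
  define s where "s = 1 + (\<Sum>i<d. qf M (w i))"
  have s: "s > 0"
    unfolding s_def using qf_nonneg[OF M w(1)] by (simp add: add_pos_nonneg sum_nonneg)
  have "1 / s * (x \<bullet> x) \<le> qf M x" if x: "x \<in> carrier_vec d" for x
  proof -
    have "(x $ i)\<^sup>2 \<le> qf M x * qf M (w i)" if "i < d" for i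
      using pos_def_Cauchy_Schwarz[OF M x w(1), of i] w(2) x that by simp
    then have "(\<Sum>i<d. (x $ i)\<^sup>2) \<le> (\<Sum>i<d. qf M x * qf M (w i))" by (intro sum_mono) auto
    then have "x \<bullet> x \<le> qf M x * (\<Sum>i<d. qf M (w i))"
      using x by (simp add: scalar_prod_def atLeast0LessThan power2_eq_square sum_distrib_left)
    also have "\<dots> \<le> qf M x * s" using qf_nonneg[OF M x] by (simp add: s_def mult_left_mono)
    finally show ?thesis using s by (simp add: field_simps)
  qed
  then show ?thesis using that[of "1 / s"] s by simp
qed

lemma qf_congruence:
  assumes K: "K \<in> carrier_mat m d" and R: "R \<in> carrier_mat m m" and z: "z \<in> carrier_vec d"
  shows "qf (K\<^sup>T * R * K) z = qf R (K *\<^sub>v z)"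
proof -
  have KT: "K\<^sup>T \<in> carrier_mat d m" using K by simp
  have Kz: "K *\<^sub>v z \<in> carrier_vec m" using K z by simp
  have w: "R *\<^sub>v (K *\<^sub>v z) \<in> carrier_vec m" using R Kz by simp
  have "(K\<^sup>T * R * K) *\<^sub>v z = K\<^sup>T *\<^sub>v (R *\<^sub>v (K *\<^sub>v z))"
    using assoc_mult_mat_vec[OF mult_carrier_mat[OF KT R] K z]
      assoc_mult_mat_vec[OF KT R Kz] by simp
  then have "qf (K\<^sup>T * R * K) z = z \<bullet> (K\<^sup>T *\<^sub>v (R *\<^sub>v (K *\<^sub>v z)))" by (simp add: qf_def)
  also have "\<dots> = (K\<^sup>T *\<^sub>v (R *\<^sub>v (K *\<^sub>v z))) \<bullet> z"
    by (rule comm_scalar_prod[OF z mult_mat_vec_carrier[OF KT w]])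
  also have "\<dots> = (R *\<^sub>v (K *\<^sub>v z)) \<bullet> (K *\<^sub>v z)"
    by (rule transpose_vec_mult_scalar[OF K z w])
  also have "\<dots> = qf R (K *\<^sub>v z)"
    unfolding qf_def by (rule comm_scalar_prod[OF w Kz])
  finally show ?thesis .
qed

section \<open>Exponential decay\<close>

lemma lyapunov_exponential_decay:
  fixes E W :: "nat \<Rightarrow> real"
  assumes a: "0 < a" and b: "0 < b" and d: "0 \<le> d" "d \<le> b"
    and lower: "\<And>t. a * E t \<le> W t" and upper: "\<And>t. W t \<le> b * E t"
    and decrease: "\<And>t. W (Suc t) \<le> W t - d * E t"
  shows "E t \<le> b / a * (1 - d / b) ^ t * E 0"
proof -
  have rate: "0 \<le> 1 - d / b" using b d by simp
  have contraction: "W (Suc t) \<le> (1 - d / b) * W t" for t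
  proof -
    have "d * (W t / b) \<le> d * E t"
      using upper[of t] b d by (intro mult_left_mono) (auto simp: field_simps)
    then show ?thesis using decrease[of t] by (simp add: algebra_simps)
  qed
  have "W t \<le> (1 - d / b) ^ t * W 0"
  proof (induction t)
    case (Suc t)
    show ?case
      using contraction[of t] mult_left_mono[OF Suc rate] by (simp add: mult.assoc)
  qed simp
  also have "\<dots> \<le> (1 - d / b) ^ t * (b * E 0)" using upper[of 0] rate by (intro mult_left_mono) auto
  finally have "a * E t \<le> (1 - d / b) ^ t * (b * E 0)" using lower[of t] by linarith
  then show ?thesis using a by (simp add: field_simps)
qed

lemma weighted_window_sum_Suc:
  fixes s :: "nat \<Rightarrow> real"
  shows "(\<Sum>j<l. real (Suc j) * s (Suc t + j))
    = (\<Sum>j<l. real (Suc j) * s (t + j)) - (\<Sum>j<l. s (t + j)) + real l * s (t + l)"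
proof -
  have "(\<Sum>j<l. real (Suc j) * s (t + j)) - (\<Sum>j<l. s (t + j)) = (\<Sum>j<l. real j * s (t + j))"
    unfolding sum_subtractf[symmetric] by (rule sum.cong) (auto simp: algebra_simps)
  then show ?thesis
    using sum.lessThan_Suc_shift[of "\<lambda>j. real j * s (t + j)" l] by simp
qed

text \<open>The weights \<open>j + 1\<close> make the weighted window sum lose the whole window sum in each step, which
  compensates for the decrease of \<open>V\<close> involving only the newest summand.\<close>
lemma window_sum_exponential_decay:
  fixes V s :: "nat \<Rightarrow> real"
  assumes l: "0 < l" and c: "0 < c" and cu: "0 < cu" and s: "\<And>k. 0 \<le> s k"
    and V_nonneg: "\<And>t. 0 \<le> V t" and V_le: "\<And>t. V t \<le> cu * (\<Sum>j<l. s (t + j))"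
    and decrease: "\<And>t. V (Suc t) \<le> V t - c * s (t + l)"
  shows "(\<Sum>j<l. s (t + j)) \<le> (cu + c) / (c / l) * (1 - c / l / (cu + c)) ^ t * (\<Sum>j<l. s j)"
proof -
  define E where "E t = (\<Sum>j<l. s (t + j))" for t
  define \<Phi> where "\<Phi> t = (\<Sum>j<l. real (Suc j) * s (t + j))" for t
  have l_ge_1: "1 \<le> real l" using l by simp
  have \<Phi>_ge: "E t \<le> \<Phi> t" for t
    unfolding E_def \<Phi>_def by (intro sum_mono) (use s in \<open>auto simp: algebra_simps\<close>)
  have \<Phi>_le: "\<Phi> t \<le> l * E t" for t
    unfolding E_def \<Phi>_def sum_distrib_left by (intro sum_mono mult_right_mono) (use s in auto)
  have \<Phi>_Suc: "\<Phi> (Suc t) = \<Phi> t - E t + l * s (t + l)" for t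
    unfolding E_def \<Phi>_def by (rule weighted_window_sum_Suc)
  have "E t \<le> (cu + c) / (c / l) * (1 - c / l / (cu + c)) ^ t * E 0"
  proof (rule lyapunov_exponential_decay[where W = "\<lambda>t. V t + c / l * \<Phi> t"])
    have "c / l \<le> c" using c l_ge_1 by (simp add: field_simps)
    then show "c / l \<le> cu + c" using cu by linarith
    show "c / l * E t \<le> V t + c / l * \<Phi> t" for t
      using mult_left_mono[OF \<Phi>_ge, of "c / l" t] V_nonneg[of t] c by simp
    show "V t + c / l * \<Phi> t \<le> (cu + c) * E t" for t
      using mult_left_mono[OF \<Phi>_le, of "c / l" t] V_le[of t] c l_ge_1
      by (simp add: E_def algebra_simps)
    show "V (Suc t) + c / l * \<Phi> (Suc t) \<le> V t + c / l * \<Phi> t - c / l * E t" for t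
      using decrease[of t] l_ge_1 by (simp add: \<Phi>_Suc ring_distribs)
  qed (use c cu l in auto)
  then show ?thesis by (simp add: E_def)
qed

section \<open>Data-driven predictive control\<close>

locale data_driven_mpc = lti_system n m p A B C D
  for n m p :: nat and A B C D :: "real mat" +
  fixes l L N :: nat
    and Q R P K :: "real mat"
    and G F :: "nat \<Rightarrow> real mat"
    and ud yd :: "nat \<Rightarrow> real vec"
    and U Y Xf :: "real vec set"
    and us ys xis :: "real vec"
    and cu :: real
  assumes ctrb: "controllable n m A B"
    and obsv: "observable n p A C"
    and ext_response: "trajectory N' u y \<Longrightarrow> l \<le> k \<Longrightarrow> k < N' \<Longrightarrow>
      y k = Ct m p l G F *\<^sub>v ext_state m p l u y (k - l) + D *\<^sub>v u k"
    and data: "trajectory N ud yd"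
    and eq: "equilibrium n m p A B C D us ys"
    and xis_eq: "xis = ext_state m p l (\<lambda>_. us) (\<lambda>_. ys) 0"
    and Q: "pos_def p Q" and R: "pos_def m R" and P: "pos_def ((m + p) * l) P"
    and L: "1 \<le> L"
    and K: "K \<in> carrier_mat m ((m + p) * l)"
    and xis_terminal: "xis \<in> Xf"
    and terminal: "xi \<in> Xf \<Longrightarrow>
      let u = us + K *\<^sub>v (xi - xis); y = Ct m p l G F *\<^sub>v xi + D *\<^sub>v u in
        At m p l G F *\<^sub>v xi + Bt m p l D *\<^sub>v u \<in> Xf \<and> u \<in> U \<and> y \<in> Y \<and>
        qf P ((At m p l G F + Bt m p l D * K) *\<^sub>v (xi - xis))
          \<le> qf P (xi - xis) - qf (K\<^sup>T * R * K) (xi - xis) - qf Q (y - ys)"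
    and cu: "0 < cu"
    and opt_value_le: "ocp_feasible m p l L N ud yd U Y Xf xi \<Longrightarrow>
      ocp_value m p l L N ud yd U Y Xf Q R P us ys xis xi \<le> cu * (vnorm (xi - xis))\<^sup>2"
    and pe: "pers_exc m (L + l + n) N ud"
begin

abbreviation "ext \<equiv> ext_state m p l"
abbreviation "feasible_sol \<equiv> ocp_feasible_sol m p l L N ud yd U Y Xf"
abbreviation "feasible \<equiv> ocp_feasible m p l L N ud yd U Y Xf"
abbreviation "optimal_sol \<equiv> ocp_optimal_sol m p l L N ud yd U Y Xf Q R P us ys xis"
abbreviation "cost \<equiv> ocp_cost m p l L Q R P us ys xis"
abbreviation "opt_value \<equiv> ocp_value m p l L N ud yd U Y Xf Q R P us ys xis"

definition stage_cost :: "real vec \<Rightarrow> real vec \<Rightarrow> real" where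
  "stage_cost u y = qf R (u - us) + qf Q (y - ys)"

definition closed_loop :: "(nat \<Rightarrow> real vec) \<Rightarrow> (nat \<Rightarrow> real vec) \<Rightarrow> bool" where
  "closed_loop u y \<longleftrightarrow> is_traj_inf n m A B C D u y \<and>
    (\<forall>t. feasible (ext u y t) \<longrightarrow> (\<exists>\<alpha> ub yb. optimal_sol (ext u y t) \<alpha> ub yb \<and> u (t + l) = ub l)) \<and>
    feasible (ext u y 0)"

lemma us_carrier: "us \<in> carrier_vec m" and ys_carrier: "ys \<in> carrier_vec p"
  using eq by (auto simp: equilibrium_def)

lemma xis_carrier: "xis \<in> carrier_vec ((m + p) * l)"
  by (simp add: xis_eq)

lemma ext_Suc:
  assumes "trajectory N' u y" "t + l < N'"
  shows "ext u y (Suc t) = At m p l G F *\<^sub>v ext u y t + Bt m p l D *\<^sub>v u (t + l)"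
  using ext_response[OF assms(1) _ assms(2)] trajectory_carrier(1)[OF assms]
  by (intro ext_state_Suc[OF D]) auto

lemma steady_response: "ys = Ct m p l G F *\<^sub>v xis + D *\<^sub>v us"
  using ext_response[OF equilibrium_trajectory[OF obsv eq], of l "Suc l"] by (simp add: xis_eq)

lemma steady_ext_state: "At m p l G F *\<^sub>v xis + Bt m p l D *\<^sub>v us = xis"
proof -
  have "xis = ext (\<lambda>_. us) (\<lambda>_. ys) (Suc 0)" unfolding xis_eq by (rule ext_state_cong) auto
  then show ?thesis
    using ext_Suc[OF equilibrium_trajectory[OF obsv eq], of 0 "Suc l"] by (simp add: xis_eq)
qed

lemma steady_constraints: "us \<in> U" "ys \<in> Y"
proof -
  have "us + K *\<^sub>v (xis - xis) = us"
    using us_carrier by (simp add: minus_cancel_vec[OF xis_carrier] mult_mat_zero_vec[OF K])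
  then show "us \<in> U" "ys \<in> Y"
    using terminal[OF xis_terminal] steady_response by (simp_all add: Let_def)
qed

lemma terminal_step:
  assumes terminal_xi: "xi \<in> Xf" and xi: "xi \<in> carrier_vec ((m + p) * l)"
  obtains v w where "v \<in> carrier_vec m" "v \<in> U" "w \<in> Y" "w = Ct m p l G F *\<^sub>v xi + D *\<^sub>v v"
    "At m p l G F *\<^sub>v xi + Bt m p l D *\<^sub>v v \<in> Xf"
    "qf P (At m p l G F *\<^sub>v xi + Bt m p l D *\<^sub>v v - xis) + stage_cost v w \<le> qf P (xi - xis)"
proof -
  define v where "v = us + K *\<^sub>v (xi - xis)"
  have dev: "xi - xis \<in> carrier_vec ((m + p) * l)" using xi xis_carrier by simp
  then have "v - us = K *\<^sub>v (xi - xis)" using K us_carrier by (intro eq_vecI) (auto simp: v_def)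
  then have "qf (K\<^sup>T * R * K) (xi - xis) = qf R (v - us)"
    using qf_congruence[OF K _ dev, of R] R by (simp add: pos_def_def)
  then show ?thesis
    using terminal[OF terminal_xi] us_carrier K dev
      feedback_deviation[OF At_carrier Bt_carrier K xi xis_carrier us_carrier steady_ext_state]
    by (intro that[of v "Ct m p l G F *\<^sub>v xi + D *\<^sub>v v"]) (auto simp: Let_def v_def stage_cost_def)
qed

lemma stage_cost_nonneg: "v \<in> carrier_vec m \<Longrightarrow> w \<in> carrier_vec p \<Longrightarrow> 0 \<le> stage_cost v w"
  using qf_nonneg[OF R, of "v - us"] qf_nonneg[OF Q, of "w - ys"] us_carrier ys_carrier
  by (simp add: stage_cost_def)

lemma stage_cost_le_cost:
  assumes "feasible_sol xi \<alpha> ub yb"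
  shows "stage_cost (ub l) (yb l) \<le> cost ub yb"
proof -
  have nonneg: "0 \<le> stage_cost (ub (l + k)) (yb (l + k))" if "k < L" for k
    using assms that by (intro stage_cost_nonneg) (simp_all add: ocp_feasible_sol_def)
  have "stage_cost (ub (l + 0)) (yb (l + 0)) \<le> (\<Sum>k<L. stage_cost (ub (l + k)) (yb (l + k)))"
    by (rule member_le_sum[of 0]) (use L nonneg in auto)
  moreover have "0 \<le> qf P (ext ub yb L - xis)"
    using qf_nonneg[OF P] xis_carrier by simp
  ultimately show ?thesis by (simp add: ocp_cost_def stage_cost_def)
qed

lemma cost_nonneg:
  assumes "feasible_sol xi \<alpha> ub yb"
  shows "0 \<le> cost ub yb"
  using stage_cost_nonneg[of "ub l" "yb l"] stage_cost_le_cost[OF assms] assms L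
  by (simp add: ocp_feasible_sol_def)

lemma cost_shift:
  "cost (\<lambda>k. u (Suc k)) (\<lambda>k. y (Suc k)) + stage_cost (u l) (y l) + qf P (ext u y L - xis)
    = cost u y + stage_cost (u (L + l)) (y (L + l)) + qf P (ext u y (Suc L) - xis)"
proof -
  let ?s = "\<lambda>k. stage_cost (u (l + k)) (y (l + k))"
  have "(\<Sum>k<L. ?s (Suc k)) + ?s 0 = (\<Sum>k<L. ?s k) + ?s L"
    using sum.lessThan_Suc_shift[of ?s L] by simp
  moreover have "ext (\<lambda>k. u (Suc k)) (\<lambda>k. y (Suc k)) L = ext u y (Suc L)"
    by (rule ext_state_cong) auto
  ultimately show ?thesis by (simp add: ocp_cost_def stage_cost_def add.commute)
qed

lemma opt_value_le_cost:
  assumes "feasible_sol xi \<alpha> ub yb"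
  shows "opt_value xi \<le> cost ub yb"
  unfolding ocp_value_def
proof (rule cInf_lower)
  show "bdd_below {cost ub yb |\<alpha> ub yb. feasible_sol xi \<alpha> ub yb}"
    using cost_nonneg by (intro bdd_belowI[of _ 0]) auto
qed (use assms in blast)

lemma opt_value_eq_cost:
  assumes "optimal_sol xi \<alpha> ub yb"
  shows "opt_value xi = cost ub yb"
  unfolding ocp_value_def
  by (rule cInf_eq_minimum) (use assms in \<open>auto simp: ocp_optimal_sol_def\<close>)

lemma closed_loop_trajectory: "closed_loop u y \<Longrightarrow> trajectory N' u y"
  unfolding closed_loop_def is_traj_inf_def is_traj_def by blast

lemma closed_loop_carrier:
  assumes "closed_loop u y"
  shows "u k \<in> carrier_vec m" and "y k \<in> carrier_vec p"
  using trajectory_carrier[OF closed_loop_trajectory[OF assms], of k "Suc k"] by simp_all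

lemma closed_loop_obtain_optimal:
  assumes "closed_loop u y" "feasible (ext u y t)"
  obtains \<alpha> ub yb where "feasible_sol (ext u y t) \<alpha> ub yb" "cost ub yb = opt_value (ext u y t)"
    "u (t + l) = ub l"
  using assms opt_value_eq_cost unfolding closed_loop_def ocp_optimal_sol_def by metis

subsection \<open>Recursive feasibility and decrease of the optimal value\<close>

context
  assumes N: "L + l + n \<le> N"
begin

lemma feasible_sol_iff_trajectory:
  "(\<exists>\<alpha>. feasible_sol xi \<alpha> ub yb) \<longleftrightarrow> trajectory (L + l) ub yb \<and>
    ext ub yb 0 = xi \<and> ext ub yb L \<in> Xf \<and> (\<forall>k<L. ub (l + k) \<in> U \<and> yb (l + k) \<in> Y)"
proof (cases "\<forall>j<L + l. ub j \<in> carrier_vec m \<and> yb j \<in> carrier_vec p")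
  case True
  then have "trajectory (L + l) ub yb \<longleftrightarrow> (\<exists>\<alpha>\<in>carrier_vec (N - (L + l) + 1).
      stack m (L + l) ub = hankel m (L + l) N ud *\<^sub>v \<alpha> \<and>
      stack p (L + l) yb = hankel p (L + l) N yd *\<^sub>v \<alpha>)"
    by (intro willems_fundamental_lemma[OF ctrb pe N data]) auto
  then show ?thesis using True unfolding ocp_feasible_sol_def by blast
next
  case False
  then show ?thesis using trajectory_carrier unfolding ocp_feasible_sol_def by blast
qed

lemma terminal_prolongation:
  assumes traj: "trajectory (L + l) u y" and terminal_L: "ext u y L \<in> Xf"
  obtains v w where "trajectory (Suc (L + l)) (u(L + l := v)) (y(L + l := w))" "v \<in> U" "w \<in> Y"
    "ext (u(L + l := v)) (y(L + l := w)) (Suc L) \<in> Xf"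
    "qf P (ext (u(L + l := v)) (y(L + l := w)) (Suc L) - xis) + stage_cost v w
        \<le> qf P (ext u y L - xis)"
proof -
  obtain v w where v: "v \<in> carrier_vec m" "v \<in> U"
    and w: "w \<in> Y" "w = Ct m p l G F *\<^sub>v ext u y L + D *\<^sub>v v"
    and step: "At m p l G F *\<^sub>v ext u y L + Bt m p l D *\<^sub>v v \<in> Xf"
      "qf P (At m p l G F *\<^sub>v ext u y L + Bt m p l D *\<^sub>v v - xis) + stage_cost v w
          \<le> qf P (ext u y L - xis)"
    using terminal_step[OF terminal_L ext_state_carrier] .
  obtain w' where traj': "trajectory (Suc (L + l)) (u(L + l := v)) (y(L + l := w'))"
    using trajectory_append[OF traj v(1)] .
  have ext_L: "ext (u(L + l := v)) (y(L + l := w')) L = ext u y L" by (rule ext_state_cong) auto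
  have "w' = w" using ext_response[OF traj', of "L + l"] ext_L w(2) by simp
  moreover have "ext (u(L + l := v)) (y(L + l := w')) (Suc L)
      = At m p l G F *\<^sub>v ext u y L + Bt m p l D *\<^sub>v v"
    using ext_Suc[OF traj', of L] ext_L by simp
  ultimately show ?thesis using that traj' v(2) w(1) step by simp
qed

lemma shifted_candidate:
  assumes sol: "feasible_sol xi \<alpha> ub yb"
  obtains \<alpha>' ub' yb' where "feasible_sol (ext ub yb 1) \<alpha>' ub' yb'"
    "cost ub' yb' + stage_cost (ub l) (yb l) \<le> cost ub yb"
proof -
  have traj: "trajectory (L + l) ub yb" and terminal_L: "ext ub yb L \<in> Xf"
    and constraints: "\<And>k. k < L \<Longrightarrow> ub (l + k) \<in> U \<and> yb (l + k) \<in> Y"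
    using sol feasible_sol_iff_trajectory[of xi ub yb] by blast+
  obtain v w where traj': "trajectory (Suc (L + l)) (ub(L + l := v)) (yb(L + l := w))"
    and vw: "v \<in> U" "w \<in> Y" and terminal': "ext (ub(L + l := v)) (yb(L + l := w)) (Suc L) \<in> Xf"
    and decrease: "qf P (ext (ub(L + l := v)) (yb(L + l := w)) (Suc L) - xis) + stage_cost v w
      \<le> qf P (ext ub yb L - xis)"
    using terminal_prolongation[OF traj terminal_L] .
  define u where "u = ub(L + l := v)"
  define y where "y = yb(L + l := w)"
  let ?u = "\<lambda>k. u (Suc k)" and ?y = "\<lambda>k. y (Suc k)"
  have shift: "ext ?u ?y t = ext u y (Suc t)" for t by (rule ext_state_cong) auto
  have "ext ?u ?y 0 = ext ub yb 1"
    unfolding shift by (rule ext_state_cong) (use L in \<open>auto simp: u_def y_def\<close>)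
  moreover have "trajectory (L + l) ?u ?y"
    using trajectory_shift[of 1 "L + l" u y] traj' by (simp add: u_def y_def)
  moreover have "?u (l + k) \<in> U \<and> ?y (l + k) \<in> Y" if "k < L" for k
    using constraints[of "Suc k"] vw that by (auto simp: u_def y_def)
  ultimately obtain \<alpha>' where sol': "feasible_sol (ext ub yb 1) \<alpha>' ?u ?y"
    using feasible_sol_iff_trajectory[of "ext ub yb 1" ?u ?y] terminal' shift[of L]
    by (auto simp: u_def y_def)
  have ext_L: "ext u y L = ext ub yb L" by (rule ext_state_cong) (auto simp: u_def y_def)
  then have "cost u y = cost ub yb" by (simp add: ocp_cost_def u_def y_def)
  then have "cost ?u ?y + stage_cost (ub l) (yb l) \<le> cost ub yb"
    using cost_shift[of u y] decrease ext_L L by (simp add: u_def y_def)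
  then show ?thesis using that sol' by blast
qed

lemma closed_loop_step:
  assumes cl: "closed_loop u y" and feas: "feasible (ext u y t)"
  shows "feasible (ext u y (Suc t))" and "u (t + l) \<in> U" and "y (t + l) \<in> Y"
    and "opt_value (ext u y (Suc t)) + stage_cost (u (t + l)) (y (t + l)) \<le> opt_value (ext u y t)"
proof -
  obtain \<alpha> ub yb where sol: "feasible_sol (ext u y t) \<alpha> ub yb"
    and cost: "cost ub yb = opt_value (ext u y t)" and u: "u (t + l) = ub l"
    using closed_loop_obtain_optimal[OF cl feas] .
  have traj: "trajectory (L + l) ub yb" and start: "ext ub yb 0 = ext u y t"
    and constraints: "\<And>k. k < L \<Longrightarrow> ub (l + k) \<in> U \<and> yb (l + k) \<in> Y"
    using sol feasible_sol_iff_trajectory[of "ext u y t" ub yb] by blast+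
  have y: "y (t + l) = yb l"
    using ext_response[OF closed_loop_trajectory[OF cl], of "t + l" "Suc (t + l)"]
      ext_response[OF traj, of l] L u start by simp
  have ext_next: "ext u y (Suc t) = ext ub yb 1"
    using ext_Suc[OF closed_loop_trajectory[OF cl], of t "Suc (t + l)"]
      ext_Suc[OF traj, of 0] L u start
    by simp
  obtain \<alpha>' ub' yb' where candidate: "feasible_sol (ext u y (Suc t)) \<alpha>' ub' yb'"
      "cost ub' yb' + stage_cost (ub l) (yb l) \<le> cost ub yb"
    using shifted_candidate[OF sol] unfolding ext_next .
  then show "feasible (ext u y (Suc t))" unfolding ocp_feasible_def by blast
  show "opt_value (ext u y (Suc t)) + stage_cost (u (t + l)) (y (t + l)) \<le> opt_value (ext u y t)"
    using opt_value_le_cost[OF candidate(1)] candidate(2) cost u y by simp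
  show "u (t + l) \<in> U" "y (t + l) \<in> Y"
    using constraints[of 0] L u y by simp_all
qed

end

subsection \<open>Degenerate dimensions\<close>

text \<open>If \<open>m = 0\<close> or \<open>l = 0\<close>, persistency of excitation does not force \<open>L + l + n \<le> N\<close>, and the
  truncated subtraction in the Hankel matrix may expose entries beyond the recorded data. The case
  \<open>l = 0\<close> arises for \<open>n = 0\<close>, where the lag is an unspecified value.\<close>
lemma closed_loop_degenerate:
  assumes degenerate: "m = 0 \<or> l = 0" and cl: "closed_loop u y"
  shows "ext u y t = xis"
proof (cases "l = 0")
  case False
  then have m: "m = 0" using degenerate by simp
  have "mrank (ctrb_mat n m A B) \<le> n * m"
    using vec_space.rank_le_nc[of "ctrb_mat n m A B" n "n * m"]
    by (simp add: ctrb_mat_def mrank_def)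
  then have n: "n = 0" using ctrb m by (simp add: controllable_def)
  have "u' k = 0\<^sub>v 0 \<and> y' k = 0\<^sub>v p" if traj: "trajectory (Suc k) u' y'" for u' y' k
  proof -
    obtain x where x: "x \<in> carrier_vec n" and u': "\<And>j. j \<le> k \<Longrightarrow> u' j \<in> carrier_vec m"
      and y': "y' k = response x u' k"
      using traj unfolding trajectory_iff by (auto simp: less_Suc_eq_le)
    have "state x u' k \<in> carrier_vec 0" "u' k \<in> carrier_vec 0"
      using state_carrier[OF x, of k u'] u' m n by simp_all
    then show ?thesis using C D m n y' by (auto simp: response_def scalar_prod_def intro!: eq_vecI)
  qed
  from this[OF closed_loop_trajectory[OF cl]] this[OF equilibrium_trajectory[OF obsv eq]]
  show ?thesis unfolding xis_eq by (intro ext_state_cong) auto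
next
  case True
  then show ?thesis unfolding xis_eq by (intro ext_state_cong) auto
qed

lemma closed_loop_at_steady_state:
  assumes cl: "closed_loop u y" and feas: "feasible (ext u y t)" and steady: "ext u y t = xis"
  shows "u (t + l) = us" and "y (t + l) = ys"
proof -
  obtain \<alpha> ub yb where sol: "feasible_sol (ext u y t) \<alpha> ub yb"
    and cost: "cost ub yb = opt_value (ext u y t)" and u: "u (t + l) = ub l"
    using closed_loop_obtain_optimal[OF cl feas] .
  have ub: "ub l \<in> carrier_vec m" and yb: "yb l \<in> carrier_vec p"
    using sol L by (simp_all add: ocp_feasible_sol_def)
  have dev: "ub l - us \<in> carrier_vec m" "yb l - ys \<in> carrier_vec p"
    using ub yb us_carrier ys_carrier by simp_all
  have "cost ub yb \<le> 0"
    using cost opt_value_le[OF feas] xis_carrier by (simp add: steady vnorm_def)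
  then have "qf R (ub l - us) = 0"
    using stage_cost_le_cost[OF sol] qf_nonneg[OF R dev(1)] qf_nonneg[OF Q dev(2)]
    by (simp add: stage_cost_def)
  then show "u (t + l) = us"
    using qf_eq_0_iff[OF R dev(1)] vec_minus_eq_0_iff[OF ub us_carrier] u by simp
  then show "y (t + l) = ys"
    using ext_response[OF closed_loop_trajectory[OF cl], of "t + l" "Suc (t + l)"] steady
      steady_response
    by simp
qed

subsection \<open>Closed-loop guarantees\<close>

lemma data_length:
  assumes "0 < m" "0 < l"
  shows "L + l + n \<le> N"
proof (rule pers_exc_imp_le_length[OF pe])
  have "1 * 2 \<le> m * (L + l + n)" using assms L by (intro mult_le_mono) auto
  then show "1 < m * (L + l + n)" by simp
qed

theorem closed_loop_feasible:
  assumes cl: "closed_loop u y"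
  shows "feasible (ext u y t)"
proof (cases "m = 0 \<or> l = 0")
  case True
  then have "ext u y t = ext u y 0" using closed_loop_degenerate[OF _ cl] by simp
  then show ?thesis using cl by (simp add: closed_loop_def)
next
  case False
  then have N: "L + l + n \<le> N" using data_length by simp
  show ?thesis
    by (induction t) (use cl closed_loop_step(1)[OF N cl] in \<open>auto simp: closed_loop_def\<close>)
qed

theorem closed_loop_constraints:
  assumes cl: "closed_loop u y"
  shows "u (t + l) \<in> U" and "y (t + l) \<in> Y"
proof -
  have "u (t + l) \<in> U \<and> y (t + l) \<in> Y"
  proof (cases "m = 0 \<or> l = 0")
    case True
    then show ?thesis
      using closed_loop_at_steady_state[OF cl closed_loop_feasible[OF cl]]
        closed_loop_degenerate[OF _ cl]
        steady_constraints by simp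
  next
    case False
    then show ?thesis using closed_loop_step(2,3)[OF data_length cl closed_loop_feasible[OF cl]]
      by simp
  qed
  then show "u (t + l) \<in> U" "y (t + l) \<in> Y" by simp_all
qed

definition deviation_sq :: "real vec \<Rightarrow> real vec \<Rightarrow> real" where
  "deviation_sq u y = (u - us) \<bullet> (u - us) + (y - ys) \<bullet> (y - ys)"

lemma deviation_sq_nonneg: "0 \<le> deviation_sq v w"
  using conjugate_square_ge_0_vec[of "v - us"] conjugate_square_ge_0_vec[of "w - ys"]
  by (simp add: deviation_sq_def)

lemma vnorm_ext_deviation:
  assumes "closed_loop u y"
  shows "vnorm (ext u y t - xis) = sqrt (\<Sum>j<l. deviation_sq (u (t + j)) (y (t + j)))"
  unfolding xis_eq ext_state_minus[OF us_carrier ys_carrier] deviation_sq_def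
  by (rule vnorm_ext_state) (use closed_loop_carrier[OF assms] us_carrier ys_carrier in auto)

lemma stage_cost_lower_bound:
  obtains c where "0 < c"
    "\<And>v w. v \<in> carrier_vec m \<Longrightarrow> w \<in> carrier_vec p \<Longrightarrow> c * deviation_sq v w \<le> stage_cost v w"
proof -
  obtain cR where cR: "0 < cR" "\<And>x. x \<in> carrier_vec m \<Longrightarrow> cR * (x \<bullet> x) \<le> qf R x"
    using pos_def_lower_bound[OF R] by blast
  obtain cQ where cQ: "0 < cQ" "\<And>x. x \<in> carrier_vec p \<Longrightarrow> cQ * (x \<bullet> x) \<le> qf Q x"
    using pos_def_lower_bound[OF Q] by blast
  have min_le: "min cR cQ * (x \<bullet> x) \<le> cR * (x \<bullet> x)" "min cR cQ * (x \<bullet> x) \<le> cQ * (x \<bullet> x)"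
    for x :: "real vec"
    using conjugate_square_ge_0_vec[of x] by (auto intro!: mult_right_mono)
  have "min cR cQ * deviation_sq v w \<le> stage_cost v w"
    if "v \<in> carrier_vec m" "w \<in> carrier_vec p" for v w
    using cR(2)[of "v - us"] cQ(2)[of "w - ys"] min_le(1)[of "v - us"] min_le(2)[of "w - ys"]
      that us_carrier ys_carrier by (simp add: deviation_sq_def stage_cost_def distrib_left)
  then show ?thesis using that[of "min cR cQ"] cR(1) cQ(1) by simp
qed

lemma closed_loop_deviation_decay:
  assumes l: "0 < l" and N: "L + l + n \<le> N" and cl: "closed_loop u y" and c: "0 < c"
    and stage: "\<And>v w. v \<in> carrier_vec m \<Longrightarrow> w \<in> carrier_vec p \<Longrightarrow> c * deviation_sq v w \<le> stage_cost v w"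
  shows "vnorm (ext u y t - xis)
    \<le> sqrt ((cu + c) / (c / l)) * sqrt (1 - c / l / (cu + c)) ^ t * vnorm (ext u y 0 - xis)"
proof -
  note feasible = closed_loop_feasible[OF cl]
  define s where "s k = deviation_sq (u k) (y k)" for k
  have vnorm_s: "vnorm (ext u y t - xis) = sqrt (\<Sum>j<l. s (t + j))" for t
    by (simp add: vnorm_ext_deviation[OF cl] s_def)
  have s_nonneg: "0 \<le> s k" for k by (simp add: s_def deviation_sq_nonneg)
  have "(\<Sum>j<l. s (t + j)) \<le> (cu + c) / (c / l) * (1 - c / l / (cu + c)) ^ t * (\<Sum>j<l. s j)"
  proof (rule window_sum_exponential_decay[where V = "\<lambda>t. opt_value (ext u y t)"])
    fix t
    obtain \<alpha> ub yb where "feasible_sol (ext u y t) \<alpha> ub yb" "cost ub yb = opt_value (ext u y t)"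
      using closed_loop_obtain_optimal[OF cl feasible] by blast
    then show "0 \<le> opt_value (ext u y t)" using cost_nonneg by fastforce
    show "opt_value (ext u y t) \<le> cu * (\<Sum>j<l. s (t + j))"
      using opt_value_le[OF feasible, of t] by (simp add: vnorm_s sum_nonneg s_nonneg)
    show "opt_value (ext u y (Suc t)) \<le> opt_value (ext u y t) - c * s (t + l)"
      using closed_loop_step(4)[OF N cl feasible, of t]
        stage[OF closed_loop_carrier[OF cl], of "t + l" "t + l"] by (simp add: s_def)
  qed (use l c cu s_nonneg in auto)
  then have "sqrt (\<Sum>j<l. s (t + j))
      \<le> sqrt ((cu + c) / (c / l) * (1 - c / l / (cu + c)) ^ t * (\<Sum>j<l. s j))"
    by (rule real_sqrt_le_mono)
  then show ?thesis unfolding vnorm_s real_sqrt_mult real_sqrt_power by simp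
qed

theorem closed_loop_exponentially_stable:
  obtains c lam where "0 < c" "0 < lam" "lam < 1"
    "\<And>u y t. closed_loop u y \<Longrightarrow> vnorm (ext u y t - xis) \<le> c * lam ^ t * vnorm (ext u y 0 - xis)"
proof (cases "m = 0 \<or> l = 0")
  case True
  then have "vnorm (ext u y t - xis) = 0" if "closed_loop u y" for u y t
    using closed_loop_degenerate[OF True that] xis_carrier by (simp add: vnorm_def)
  then show ?thesis using that[of 1 "1 / 2"] by simp
next
  case False
  then have l: "0 < l" and N: "L + l + n \<le> N" using data_length by auto
  obtain c where c: "0 < c" "\<And>v w. v \<in> carrier_vec m \<Longrightarrow> w \<in> carrier_vec p \<Longrightarrow>
      c * deviation_sq v w \<le> stage_cost v w"
    using stage_cost_lower_bound by blast
  have "c / l \<le> c" using c(1) l by (simp add: field_simps)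
  then have "c / l < cu + c" using cu by linarith
  then have "0 < (cu + c) / (c / l)" "0 < 1 - c / l / (cu + c)" "1 - c / l / (cu + c) < 1"
    using c(1) cu l by (simp_all add: field_simps)
  then show ?thesis
    using that[of "sqrt ((cu + c) / (c / l))" "sqrt (1 - c / l / (cu + c))"]
      closed_loop_deviation_decay[OF l N _ c] by simp
qed

end

lemma interior_pt_imp_mem:
  assumes "interior_pt d S x"
  shows "x \<in> S"
proof -
  obtain e where "x \<in> carrier_vec d" "0 < e" "\<And>z. z \<in> carrier_vec d \<Longrightarrow> vnorm (z - x) < e \<Longrightarrow> z \<in> S"
    using assms by (auto simp: interior_pt_def)
  then show ?thesis by (simp add: vnorm_def)
qed

theorem theorem2:
  fixes n m p l L N :: nat
    and A B C D Q R P K :: "real mat"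
    and G F :: "nat \<Rightarrow> real mat"
    and ud yd :: "nat \<Rightarrow> real vec"
    and U Y Xf :: "real vec set"
    and us ys :: "real vec"
  defines "xis \<equiv> ext_state m p l (\<lambda>_. us) (\<lambda>_. ys) 0"
  assumes dims: "A \<in> carrier_mat n n" "B \<in> carrier_mat n m" "C \<in> carrier_mat p n"
      "D \<in> carrier_mat p m"
    and ctrb: "controllable n m A B"
    and obsv: "observable n p A C"
    and l_ge: "lag n p A C \<le> l"
    and GF_dims: "\<forall>i\<in>{1..l}. G i \<in> carrier_mat p m \<and> F i \<in> carrier_mat p p"
    and GF_ext: "\<forall>N' u y. is_traj n m A B C D N' u y \<longrightarrow>
        (\<forall>k. l \<le> k \<and> k < N' \<longrightarrow>
           y k = Ct m p l G F *\<^sub>v ext_state m p l u y (k - l) + D *\<^sub>v u k)"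
    and data: "is_traj n m A B C D N ud yd"
    and UY: "U \<subseteq> carrier_vec m" "Y \<subseteq> carrier_vec p"
    and eq: "equilibrium n m p A B C D us ys"
    and eq_int: "interior_pt (m + p) {u @\<^sub>v y | u y. u \<in> U \<and> y \<in> Y} (us @\<^sub>v ys)"
    and QR: "pos_def p Q" "pos_def m R"
    and L_ge: "1 \<le> L"
    and A1_P: "pos_def ((m + p) * l) P"
    and A1_K: "K \<in> carrier_mat m ((m + p) * l)"
    and A1_Xf: "Xf \<subseteq> prod_constr m p l U Y" "interior_pt ((m + p) * l) Xf xis"
    and A1: "\<forall>xi\<in>Xf.
        let u = us + K *\<^sub>v (xi - xis); y = Ct m p l G F *\<^sub>v xi + D *\<^sub>v u in
          At m p l G F *\<^sub>v xi + Bt m p l D *\<^sub>v u \<in> Xf \<and>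
          u \<in> U \<and> y \<in> Y \<and>
          qf P ((At m p l G F + Bt m p l D * K) *\<^sub>v (xi - xis))
            \<le> qf P (xi - xis) - qf (transpose_mat K * R * K) (xi - xis) - qf Q (y - ys)"
    and A2: "\<exists>cu>0. \<forall>xi. ocp_feasible m p l L N ud yd U Y Xf xi \<longrightarrow>
        ocp_value m p l L N ud yd U Y Xf Q R P us ys xis xi \<le> cu * (vnorm (xi - xis))\<^sup>2"
    and A3: "pers_exc m (L + l + n) N ud"
  shows "\<exists>c lam. c > 0 \<and> 0 < lam \<and> lam < 1 \<and>
     (\<forall>u y. is_traj_inf n m A B C D u y \<longrightarrow>
        (\<forall>t. ocp_feasible m p l L N ud yd U Y Xf (ext_state m p l u y t) \<longrightarrow>
           (\<exists>alpha ub yb. ocp_optimal_sol m p l L N ud yd U Y Xf Q R P us ys xis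
                (ext_state m p l u y t) alpha ub yb \<and> u (t + l) = ub l)) \<longrightarrow>
        ocp_feasible m p l L N ud yd U Y Xf (ext_state m p l u y 0) \<longrightarrow>
        (\<forall>t. ocp_feasible m p l L N ud yd U Y Xf (ext_state m p l u y t)) \<and>
        (\<forall>t. u (t + l) \<in> U \<and> y (t + l) \<in> Y) \<and>
        (\<forall>t. vnorm (ext_state m p l u y t - xis)
               \<le> c * lam ^ t * vnorm (ext_state m p l u y 0 - xis)))"
proof -
  obtain cu where cu: "0 < cu" "\<And>xi. ocp_feasible m p l L N ud yd U Y Xf xi \<Longrightarrow>
      ocp_value m p l L N ud yd U Y Xf Q R P us ys xis xi \<le> cu * (vnorm (xi - xis))\<^sup>2"
    using A2 by blast
  interpret data_driven_mpc n m p A B C D l L N Q R P K G F ud yd U Y Xf us ys xis cu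
    by unfold_locales
      (use dims ctrb obsv GF_ext data eq QR L_ge A1_P A1_K A1 A3 cu interior_pt_imp_mem[OF A1_Xf(2)]
        in \<open>auto simp: xis_def\<close>)
  obtain c lam where "0 < c" "0 < lam" "lam < 1"
    "\<And>u y t. closed_loop u y \<Longrightarrow> vnorm (ext u y t - xis) \<le> c * lam ^ t * vnorm (ext u y 0 - xis)"
    using closed_loop_exponentially_stable by blast
  moreover have "(\<forall>t. feasible (ext u y t)) \<and> (\<forall>t. u (t + l) \<in> U \<and> y (t + l) \<in> Y)"
    if "closed_loop u y" for u y
    using closed_loop_feasible[OF that] closed_loop_constraints[OF that] by blast
  ultimately show ?thesis
    unfolding closed_loop_def by (intro exI[of _ c] exI[of _ lam]) blast
qed

end
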